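(* Let $\mu\in(1,\infty)$ and let $\mathbf p(t)=(p_0(t),p_1(t),\ldots)$ be a solution of the system of ODEs $$p_0'=-(\mu-1+p_0)\,p_0,\qquad p_n'=n\,p_{n+1}+(\mu-1+p_0)\,p_{n-1}-(n-1)\,p_n-(\mu-1+p_0)\,p_n\quad(n\ge1),$$ with $\mathbf p(0)\in\mathcal S_\mu$. Then there is a positive (finite) constant $C$, independent of $t$, such that for all $t\ge0$, $$\|\mathbf p(t)-\overline{\mathbf p}\|_{\mathcal H}^2\le\begin{cases}C\,t\,e^{-(\mu-1)t} & \text{if } 1<\mu<3,\\ C\,t^2\,e^{-2t} & \text{if } \mu=3,\\ C\,e^{-2t} & \text{if } \mu>3.\end{cases}$$
   Context: $\mathbb N=\{0,1,2,\ldots\}$. For $\mu>0$, $\mathcal S_\mu=\{\mathbf p=(p_n)_{n\ge0} \mid p_n\ge 0,\ \sum_{n\ge0}p_n=1,\ \sum_{n\ge0} n\,p_n=\mu\}$. Total mass and mean are conserved by the system, and the solution $\mathbf p(t)$ with $\mathbf p(0)\in\mathcal S_\mu$ is understood to lie in $\mathcal S_\mu$ for all $t\ge0$. For $\mu>1$ the modified Poisson distribution $\overline{\mathbf p}=(\overline p_n)_{n\ge0}$ is $$\overline p_0=0,\qquad \overline p_n=\frac{(\mu-1)^{n-1}}{(n-1)!}\,e^{-(\mu-1)}\quad(n\ge1).$$ $\mathcal H=\{\mathbf p\in\ell^2(\mathbb N)\mid p_0^2+\sum_{n\ge1}p_n^2/\overline p_n<+\infty\}$ with scalar product $\langle\mathbf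 p,\mathbf q\rangle_{\mathcal H}=p_0q_0+\sum_{n\ge1}\frac{p_nq_n}{\overline p_n}$ and induced norm $\|\cdot\|_{\mathcal H}$. $C$ is a generic constant in the sense that its value may differ from one case to another.
   Formalization: The formal theorem also assumes p(0) lies in H (otherwise the norm is infinite at t=0), and for 1<μ≤3 the factor t is replaced by max(1,t), since at t=0 the stated bound is 0 and fails unless p(0) equals the modified Poisson distribution. *)

theory Defs
  imports Complex_Main
begin

definition S_space :: "real \<Rightarrow> (nat \<Rightarrow> real) set" where
  "S_space \<mu> = {p. (\<forall>n. p n \<ge> 0) \<and> p sums 1 \<and> (\<lambda>n. real n * p n) sums \<mu>}"

definition pbar :: "real \<Rightarrow> nat \<Rightarrow> real" where
  "pbar \<mu> n = (if n = 0 then 0 else (\<mu> - 1) ^ (n - 1) / fact (n - 1) * exp (- (\<mu> - 1)))"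

definition H_space :: "real \<Rightarrow> (nat \<Rightarrow> real) set" where
  "H_space \<mu> = {p. summable (\<lambda>n. (p n)\<^sup>2) \<and> summable (\<lambda>n. (p (Suc n))\<^sup>2 / pbar \<mu> (Suc n))}"

(* H_inner and H_norm are meaningful only on H_space: elsewhere the series may diverge
   and suminf is then unspecified, so bounds on H_norm must come with membership in H_space. *)

definition H_inner :: "real \<Rightarrow> (nat \<Rightarrow> real) \<Rightarrow> (nat \<Rightarrow> real) \<Rightarrow> real" where
  "H_inner \<mu> p q = p 0 * q 0 + (\<Sum>n. p (Suc n) * q (Suc n) / pbar \<mu> (Suc n))"

definition H_norm :: "real \<Rightarrow> (nat \<Rightarrow> real) \<Rightarrow> real" where
  "H_norm \<mu> p = sqrt (H_inner \<mu> p p)"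

(* The ODEs hold componentwise on [0, \<infinity>), with a one-sided derivative at 0. Remaining in
   S_space is part of being a solution: the p_0 equation is closed, and for n \<ge> 1 the n-th
   equation merely expresses p_{n+1} through p_0, ..., p_n and p_n', so the componentwise
   equations alone do not determine p from p 0. *)

definition is_solution :: "real \<Rightarrow> (real \<Rightarrow> nat \<Rightarrow> real) \<Rightarrow> bool" where
  "is_solution \<mu> p \<longleftrightarrow>
     (\<forall>t\<ge>0. p t \<in> S_space \<mu>) \<and>
     (\<forall>t\<ge>0. ((\<lambda>s. p s 0) has_real_derivative - (\<mu> - 1 + p t 0) * p t 0) (at t within {0..})) \<and>
     (\<forall>t\<ge>0. \<forall>n\<ge>1. ((\<lambda>s. p s n) has_real_derivative
        (real n * p t (n + 1) + (\<mu> - 1 + p t 0) * p t (n - 1)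
         - (real n - 1) * p t n - (\<mu> - 1 + p t 0) * p t n)) (at t within {0..}))"

end

theory Submission
  imports Defs "HOL-Analysis.Analysis"
begin

text \<open>
  Put \<open>a = \<mu> - 1\<close>, \<open>x = p\<^sub>0\<close> and \<open>q\<^sub>n = p\<^sub>n\<^sub>+\<^sub>1\<close>. Then \<open>x \<le> exp (- a t)\<close>, and \<open>q\<close> evolves as an
  M/M/\<open>\<infinity>\<close> queue with arrival rate \<open>a + x\<close> and a source \<open>(a + x) x\<close> at \<open>0\<close>; for \<open>x = 0\<close> its generator
  is diagonalised by the Charlier polynomials \<open>e\<^sub>k\<close>.
  The coefficients \<open>c\<^sub>k = (\<Sum>n. q\<^sub>n e\<^sub>k(n))\<close> solve the triangular system
  \<open>c\<^sub>k' = - k c\<^sub>k + x c\<^sub>k\<^sub>-\<^sub>1 + (a + x) x e\<^sub>k(0)\<close>, so that the energy \<open>E\<close> of the modes \<open>1, \<dots>, K\<close>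
  involves no further mode and satisfies \<open>E' \<le> - 2 E + C exp (- a t) (E + 1)\<close>. Gronwall's inequality,
  uniformly in \<open>K\<close>, and completeness of the Charlier system give the three decay rates.
  To have all coefficients at positive times, one shows first that the tails
  \<open>T\<^sub>n = (\<Sum>m>n. p\<^sub>m)\<close>, which satisfy \<open>T\<^sub>n' \<le> (a + 1) T\<^sub>n\<^sub>-\<^sub>1\<close>, keep decaying faster than every
  geometric sequence.
\<close>

subsection \<open>Charlier polynomials\<close>

text \<open>\<open>charlier a k n\<close> is the coefficient of \<open>w ^ k\<close> in \<open>exp (- a * w) * (1 + w) ^ n\<close>.\<close>

fun charlier :: "real \<Rightarrow> nat \<Rightarrow> nat \<Rightarrow> real" where
  "charlier a k 0 = (- a) ^ k / fact k"
| "charlier a 0 (Suc n) = charlier a 0 n"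
| "charlier a (Suc k) (Suc n) = charlier a (Suc k) n + charlier a k n"

text \<open>The reciprocal of the squared norm \<open>a ^ k / fact k\<close> of
  \<open>charlier a k\<close> under the Poisson law.\<close>

definition charlier_weight :: "real \<Rightarrow> nat \<Rightarrow> real" where
  "charlier_weight a k = fact k / a ^ k"

definition poisson :: "real \<Rightarrow> nat \<Rightarrow> real" where
  "poisson a n = a ^ n / fact n * exp (- a)"

text \<open>Unweighted pairing: for a sequence \<open>u\<close> it is the coefficient of the density
  \<open>u / poisson a\<close> in the Poisson-weighted inner product.\<close>

definition charlier_coeff :: "real \<Rightarrow> (nat \<Rightarrow> real) \<Rightarrow> nat \<Rightarrow> real" where
  "charlier_coeff a u k = (\<Sum>n. u n * charlier a k n)"

lemma charlier_0 [simp]: "charlier a 0 n = 1"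
  by (induction n) auto

text \<open>Differentiate the generating function in \<open>w\<close> and compare coefficients of
  \<open>w ^ k\<close>. At \<open>n = 0\<close> the truncated \<open>n - 1\<close> is harmless, as
  its factor vanishes.\<close>

lemma charlier_rec:
  "(real k + 1) * charlier a (Suc k) n = real n * charlier a k (n - 1) - a * charlier a k n"
proof (induction n arbitrary: k)
  case 0
  have "(real k + 1) * ((- a) * (- a) ^ k / ((real k + 1) * fact k)) = - (a * (- a) ^ k / fact k)"
    by (simp add: divide_simps)
  then show ?case by (simp add: algebra_simps)
next
  case (Suc n)
  show ?case
  proof (cases k)
    case 0
    then show ?thesis using Suc[of 0] by (simp add: algebra_simps)
  next
    case (Suc j)
    \<comment> \<open>Pascal's rule one step lower; for \<open>n = 0\<close> both sides
      vanish.\<close>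
    have shift: "real n * charlier a (Suc j) n
        = real n * charlier a (Suc j) (n - 1) + real n * charlier a j (n - 1)"
      by (cases n) (auto simp: algebra_simps)
    show ?thesis
      using Suc.IH[of "Suc j"] Suc.IH[of j] shift unfolding Suc by (simp add: algebra_simps)
  qed
qed

section \<open>Weights and the Poisson law\<close>

lemma charlier_weight_Suc: "a > 0 \<Longrightarrow> charlier_weight a (Suc k) = (real k + 1) / a * charlier_weight a k"
  by (simp add: charlier_weight_def field_simps)

lemma charlier_weight_pos: "a > 0 \<Longrightarrow> charlier_weight a k > 0"
  by (simp add: charlier_weight_def)

lemma poisson_pos: "a > 0 \<Longrightarrow> poisson a n > 0"
  by (simp add: poisson_def)

lemma poisson_sums: "poisson a sums 1"
proof -
  have "(\<lambda>n. a ^ n / fact n * exp (- a)) sums (exp a * exp (- a))"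
    by (intro sums_mult2) (use exp_converges[of a] in \<open>simp add: field_simps scaleR_conv_of_real\<close>)
  then show ?thesis by (simp add: poisson_def[abs_def] exp_minus)
qed

lemma poisson_le_1: 
  assumes "a > 0" shows "poisson a n \<le> 1"
  using sum_le_suminf[of "poisson a" "{n}"] poisson_sums[of a] poisson_pos[OF assms]
  by (simp add: sums_iff less_imp_le)

text \<open>Pascal's rule at most doubles the bound with each step in \<open>n\<close>. Uniformity
  in \<open>k\<close> lets one majorant serve all degrees.\<close>

lemma charlier_bound: 
  assumes "a > 0" 
  shows "\<bar>charlier a k n\<bar> \<le> exp a * 2 ^ n"
proof (induction n arbitrary: k)
  case 0
  have "a ^ k / fact k \<le> exp a"
    using poisson_le_1[OF assms, of k] by (simp add: poisson_def exp_minus field_simps)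
  then show ?case using assms by (simp add: power_abs)
next
  case (Suc n)
  show ?case
  proof (cases k)
    case 0
    have "1 \<le> exp a * 2 ^ Suc n"
      using mult_mono[of 1 "exp a" 1 "2 ^ Suc n"] assms one_le_power[of "2 :: real" "Suc n"] by simp
    with 0 show ?thesis by simp
  next
    case (Suc j)
    show ?thesis using Suc.IH[of "Suc j"] Suc.IH[of j] unfolding Suc by simp
  qed
qed

text \<open>The generating function is majorised coefficientwise by
  \<open>exp ((a + n) * w)\<close>. The \<open>fact k\<close> below cancels the one in
  \<open>charlier_weight\<close>.\<close>

lemma charlier_abs_le:
  assumes "a > 0"
  shows "\<bar>charlier a k n\<bar> \<le> (a + n) ^ k / fact k"
proof (induction n arbitrary: k)
  case 0
  then show ?case using assms by (simp add: power_abs)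
next
  case (Suc n)
  show ?case
  proof (cases k)
    case 0
    with Suc show ?thesis by simp
  next
    case (Suc j)
    define b where "b = a + n"
    have b: "b \<ge> 0" using assms by (simp add: b_def)
    \<comment> \<open>The first two terms of the binomial expansion of
      \<open>(b + 1) ^ Suc j\<close>.\<close>
    have bern: "b ^ Suc j + (real j + 1) * b ^ j \<le> (b + 1) ^ Suc j"
    proof (induction j)
      case (Suc j)
      have "(b + 1) * (b ^ Suc j + (real j + 1) * b ^ j) \<le> (b + 1) * (b + 1) ^ Suc j"
        using Suc b by (intro mult_left_mono) auto
      moreover have "0 \<le> (real j + 1) * b ^ j" using b by simp
      ultimately show ?case by (simp add: algebra_simps)
    qed simp
    have "\<bar>charlier a (Suc j) n + charlier a j n\<bar> \<le> b ^ Suc j / fact (Suc j) + b ^ j / fact j"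
      using Suc.IH[of "Suc j"] Suc.IH[of j] unfolding b_def by linarith
    also have "\<dots> = (b ^ Suc j + (real j + 1) * b ^ j) / fact (Suc j)"
    proof -
      have "(real j + 1) * b ^ j / fact (Suc j) = b ^ j / fact j"
        by (simp add: add.commute[of 1] mult.assoc del: of_nat_Suc) (simp add: divide_simps)
      then show ?thesis by (simp only: add_divide_distrib)
    qed
    also have "\<dots> \<le> (b + 1) ^ Suc j / fact (Suc j)"
      using bern by (intro divide_right_mono) auto
    finally show ?thesis unfolding Suc b_def by (simp add: algebra_simps)
  qed
qed

text \<open>With all signs made positive the generating function at \<open>r\<close> is
  \<open>exp (a * r) * (1 + r) ^ n\<close>; each step in \<open>n\<close> costs a factor
  \<open>1 + r\<close>.\<close>

lemma charlier_power_sum: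
  assumes "a > 0" "r \<ge> 0"
  shows "summable (\<lambda>k. r ^ k * \<bar>charlier a k n\<bar>) \<and> (\<Sum>k. r ^ k * \<bar>charlier a k n\<bar>) \<le> exp (a * r) * (1 + r) ^ n"
proof (induction n)
  case 0
  have eq: "(\<lambda>k. r ^ k * \<bar>charlier a k 0\<bar>) = (\<lambda>k. (a * r) ^ k /\<^sub>R fact k)"
    using assms by (auto simp: power_abs power_mult_distrib field_simps)
  show ?case unfolding eq using exp_converges[of "a * r"] by (simp add: sums_iff)
next
  case (Suc n)
  let ?f = "\<lambda>k. r ^ k * \<bar>charlier a k n\<bar>"
  let ?g = "\<lambda>k. r ^ k * \<bar>charlier a k (Suc n)\<bar>"
  have s: "summable ?f" using Suc by simp
  have g: "?g (Suc k) \<le> ?f (Suc k) + r * ?f k" for k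
  proof -
    have "?g (Suc k) \<le> r ^ Suc k * (\<bar>charlier a (Suc k) n\<bar> + \<bar>charlier a k n\<bar>)"
      using assms by (intro mult_left_mono) auto
    then show ?thesis by (simp add: algebra_simps)
  qed
  have s1: "summable (\<lambda>k. ?f (Suc k))" using s by (subst summable_Suc_iff)
  have s2: "summable (\<lambda>k. ?f (Suc k) + r * ?f k)"
    using s s1 by (intro summable_add summable_mult)
  have s3: "summable (\<lambda>k. ?g (Suc k))"
    by (rule summable_comparison_test'[OF s2]) (use assms g in auto)
  then have s4: "summable ?g" by (subst (asm) summable_Suc_iff)
  have "(\<Sum>k. ?g k) = ?g 0 + (\<Sum>k. ?g (Suc k))" using suminf_split_head[OF s4] by simp
  also have "\<dots> \<le> ?f 0 + (\<Sum>k. ?f (Suc k) + r * ?f k)"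
    using suminf_le[OF g s3 s2] by simp
  also have "\<dots> = ?f 0 + (\<Sum>k. ?f (Suc k)) + r * (\<Sum>k. ?f k)"
    using suminf_add[OF s1 summable_mult[OF s, of r]] suminf_mult[OF s, of r] by simp
  also have "\<dots> = (1 + r) * (\<Sum>k. ?f k)" using suminf_split_head[OF s] by (simp add: algebra_simps)
  also have "\<dots> \<le> (1 + r) * (exp (a * r) * (1 + r) ^ n)" 
    using Suc assms by (intro mult_left_mono) auto
  finally show ?case using s4 by (simp add: algebra_simps)
qed

text \<open>\<open>r\<close> is chosen so that weight times \<open>charlier_abs_le\<close> at
  \<open>m\<close> is exactly \<open>r ^ k\<close>. The bound is geometric in \<open>n\<close> and
  uniform in \<open>K\<close>, as dominated convergence will require.\<close>

lemma charlier_kernel_abs: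
  assumes a: "a > 0" and r: "r = (a + real m) / a"
  shows "summable (\<lambda>k. charlier_weight a k * \<bar>charlier a k m\<bar> * \<bar>charlier a k n\<bar>)" (is "summable ?f")
    and "(\<Sum>k<K. charlier_weight a k * \<bar>charlier a k m\<bar> * \<bar>charlier a k n\<bar>) \<le> exp (a * r) * (1 + r) ^ n"
proof -
  have r0: "r \<ge> 0" using assms by simp
  have le: "?f k \<le> r ^ k * \<bar>charlier a k n\<bar>" for k
  proof -
    have "charlier_weight a k * \<bar>charlier a k m\<bar> \<le> charlier_weight a k * ((a + m) ^ k / fact k)"
      using charlier_abs_le[OF a] charlier_weight_pos[OF a] by (intro mult_left_mono) (auto simp: less_imp_le)
    also have "\<dots> = r ^ k" using a by (simp add: charlier_weight_def r power_divide)
    finally show ?thesis by (intro mult_right_mono) auto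
  qed
  have f0: "?f k \<ge> 0" for k using charlier_weight_pos[OF a, of k] by simp
  note ps = charlier_power_sum[OF a r0, of n]
  show s: "summable ?f"
    by (rule summable_comparison_test'[OF conjunct1[OF ps], of 0]) (metis f0 le abs_of_nonneg real_norm_def)
  have "sum ?f {..<K} \<le> (\<Sum>k. ?f k)" by (rule sum_le_suminf[OF s]) (use f0 in auto)
  also have "\<dots> \<le> (\<Sum>k. r ^ k * \<bar>charlier a k n\<bar>)" using le s ps by (intro suminf_le) auto
  finally show "sum ?f {..<K} \<le> exp (a * r) * (1 + r) ^ n" using ps by linarith
qed

lemma charlier_kernel_summable:
  assumes a: "a > 0"
  shows "summable (\<lambda>k. charlier_weight a k * charlier a k n * charlier a k m)"
  by (rule summable_comparison_test'[OF charlier_kernel_abs(1)[OF a refl, of n m]])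
    (use charlier_weight_pos[OF a] in \<open>simp add: abs_mult less_imp_le\<close>)

text \<open>Pascal's rule splits the factor at \<open>Suc n\<close>; \<open>charlier_rec\<close> at
  \<open>m\<close> turns the second piece into a kernel term at \<open>(n, m - 1)\<close> minus one
  at \<open>(n, m)\<close>, and the latter telescopes against the first piece.\<close>

lemma charlier_kernel_step:
  assumes a: "a > 0"
  shows "(\<Sum>k. charlier_weight a k * charlier a k (Suc n) * charlier a k m)
    = real m / a * (\<Sum>k. charlier_weight a k * charlier a k n * charlier a k (m - 1))"
proof -
  let ?B = "\<lambda>n m k. charlier_weight a k * charlier a k n * charlier a k m"
  note s = charlier_kernel_summable[OF a]
  have step: "?B (Suc n) m (Suc k) = ?B n m (Suc k) + (real m / a * ?B n (m - 1) k - ?B n m k)" for k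
  proof -
    have "charlier_weight a (Suc k) * charlier a k n * charlier a (Suc k) m
        = charlier_weight a k * charlier a k n / a * ((real k + 1) * charlier a (Suc k) m)"
      using a by (simp add: charlier_weight_Suc)
    also have "\<dots> = real m / a * ?B n (m - 1) k - ?B n m k"
      unfolding charlier_rec using a by (simp add: field_simps)
    finally show ?thesis by (simp add: algebra_simps)
  qed
  have "(\<lambda>k. ?B n m (Suc k)) sums (suminf (?B n m) - ?B n m 0)"
    using summable_sums[OF s, of n m] by (subst sums_Suc_iff) simp
  then have "(\<lambda>k. ?B (Suc n) m (Suc k)) sums ((suminf (?B n m) - ?B n m 0)
      + (real m / a * suminf (?B n (m - 1)) - suminf (?B n m)))"
    unfolding step by (intro sums_add sums_diff sums_mult summable_sums s)
  \<comment> \<open>The two leading terms \<open>?B n m 0\<close> and \<open>?B (Suc n) m 0\<close>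
    are both 1 and cancel.\<close>
  then have "?B (Suc n) m sums (real m / a * suminf (?B n (m - 1)))"
    by (subst (asm) sums_Suc_iff) simp
  then show ?thesis by (simp add: sums_iff)
qed

text \<open>This dual orthogonality relation (the sum runs over the degree) yields both Bessel's
  inequality and completeness; orthogonality with respect to the Poisson law is not needed.\<close>

lemma charlier_kernel:
  assumes a: "a > 0"
  shows "(\<lambda>k. charlier_weight a k * charlier a k n * charlier a k m) sums (if n = m then 1 / poisson a n else 0)"
proof -
  let ?B = "\<lambda>n m. \<Sum>k. charlier_weight a k * charlier a k n * charlier a k m"
  have sym: "?B n m = ?B m n" for n m by (simp add: mult_ac)
  have B00: "?B 0 0 = exp a"
  proof -
    have "charlier_weight a k * charlier a k 0 * charlier a k 0 = a ^ k /\<^sub>R fact k" for k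
    proof -
      have "(- a) ^ k * (- a) ^ k = a ^ k * a ^ k" by (simp flip: power_mult_distrib)
      then show ?thesis using a by (simp add: charlier_weight_def field_simps)
    qed
    then show ?thesis using exp_converges[of a] by (simp add: sums_iff)
  qed
  have "?B n m = (if n = m then 1 / poisson a n else 0)"
  proof (induction n arbitrary: m)
    case 0
    show ?case
    proof (cases m)
      case 0
      then show ?thesis using B00 by (simp add: poisson_def exp_minus inverse_eq_divide del: charlier.simps)
    next
      case (Suc j)
      \<comment> \<open>By symmetry the step applies with second index 0, where its factor
        \<open>real m\<close> vanishes.\<close>
      then show ?thesis using charlier_kernel_step[OF a, of j 0] sym[of 0 m] by simp
    qed
  next
    case (Suc n)
    then show ?case using a unfolding charlier_kernel_step[OF a]
      by (cases m) (auto simp: poisson_def field_simps)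
  qed
  with charlier_kernel_summable[OF a, of n m] show ?thesis by (simp add: sums_iff)
qed

text \<open>Expanding the square and summing the kernel over all \<open>k\<close> gives equality;
  truncating a series of nonnegative terms leaves the inequality.\<close>

lemma charlier_finite_parseval:
  assumes a: "a > 0"
  shows "(\<Sum>k<K. charlier_weight a k * (\<Sum>n<N. v n * charlier a k n)\<^sup>2) \<le> (\<Sum>n<N. (v n)\<^sup>2 / poisson a n)"
proof -
  let ?w = "charlier_weight a" and ?e = "charlier a"
  have "(\<lambda>k. \<Sum>n<N. \<Sum>m<N. v n * v m * (?w k * ?e k n * ?e k m)) sums
      (\<Sum>n<N. \<Sum>m<N. v n * v m * (if n = m then 1 / poisson a n else 0))"
    by (intro sums_sum sums_mult charlier_kernel[OF a])
  also have "(\<lambda>k. \<Sum>n<N. \<Sum>m<N. v n * v m * (?w k * ?e k n * ?e k m)) = (\<lambda>k. ?w k * (\<Sum>n<N. v n * ?e k n)\<^sup>2)"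
    by (simp add: power2_eq_square sum_product sum_distrib_left algebra_simps)
  also have "(\<Sum>n<N. \<Sum>m<N. v n * v m * (if n = m then 1 / poisson a n else 0)) = (\<Sum>n<N. (v n)\<^sup>2 / poisson a n)"
    by (simp add: power2_eq_square if_distrib cong: if_cong)
  finally have *: "(\<lambda>k. ?w k * (\<Sum>n<N. v n * ?e k n)\<^sup>2) sums (\<Sum>n<N. (v n)\<^sup>2 / poisson a n)" .
  show ?thesis using sum_le_suminf[of _ "{..<K}", OF sums_summable[OF *]] sums_unique[OF *] charlier_weight_pos[OF a] 
    by (simp add: less_imp_le)
qed

subsection \<open>Rapidly decaying sequences and their Charlier expansion\<close>

text \<open>Every rate \<open>R\<close> is demanded because the kernel at \<open>m\<close> grows
  like \<open>(1 + r) ^ n\<close> with \<open>r\<close> depending on \<open>m\<close>.\<close>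

definition rapidly_decaying :: "(nat \<Rightarrow> real) \<Rightarrow> bool" where
  "rapidly_decaying u \<longleftrightarrow> (\<forall>R>0. \<exists>M. \<forall>n. \<bar>u n\<bar> * R ^ n \<le> M)"

text \<open>Controlling \<open>u\<close> at twice the growth rate of \<open>b\<close> leaves a spare
  \<open>(1 / 2) ^ n\<close>, with constants free of parameters hidden in \<open>u\<close> and
  \<open>b\<close>.\<close>

lemma geometric_majorant:
  fixes u b :: "nat \<Rightarrow> real"
  assumes "\<And>n. \<bar>u n\<bar> * (2 * r) ^ n \<le> M" "\<And>n. \<bar>b n\<bar> \<le> A * r ^ n" "r > 0"
  shows "\<bar>u n * b n\<bar> \<le> A * M * (1 / 2) ^ n"
proof -
  have A: "A \<ge> 0" using order_trans[OF abs_ge_zero assms(2)[of 0]] by simp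
  have "\<bar>u n * b n\<bar> \<le> \<bar>u n\<bar> * (A * r ^ n)"
    unfolding abs_mult using assms(2) by (intro mult_left_mono) auto
  also have "\<dots> = A * (1 / 2) ^ n * (\<bar>u n\<bar> * (2 * r) ^ n)"
    by (simp add: field_simps)
  also have "\<dots> \<le> A * (1 / 2) ^ n * M"
    using assms(1) A by (intro mult_left_mono) auto
  finally show ?thesis by (simp add: algebra_simps)
qed

lemma summable_half: "summable (\<lambda>n. c * (1 / 2 :: real) ^ n)"
  by (intro summable_mult summable_geometric) simp

lemma rapidly_decaying_summable:
  assumes "rapidly_decaying u" "\<And>n. \<bar>b n\<bar> \<le> A * r ^ n" "r > 0"
  shows "summable (\<lambda>n. u n * b n)"
proof -
  obtain M where M: "\<And>n. \<bar>u n\<bar> * (2 * r) ^ n \<le> M"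
    using assms(1,3) unfolding rapidly_decaying_def by (metis mult_pos_pos zero_less_numeral)
  show ?thesis
    by (rule summable_comparison_test'[OF summable_half])
      (use geometric_majorant[OF M assms(2,3)] in auto)
qed

lemma rapidly_decaying_diff:
  assumes "rapidly_decaying u" "rapidly_decaying v"
  shows "rapidly_decaying (\<lambda>n. u n - v n)"
  unfolding rapidly_decaying_def
proof (intro allI impI)
  fix R :: real assume R: "R > 0"
  then obtain M M' where "\<And>n. \<bar>u n\<bar> * R ^ n \<le> M" "\<And>n. \<bar>v n\<bar> * R ^ n \<le> M'"
    using assms unfolding rapidly_decaying_def by metis
  then have "\<bar>u n - v n\<bar> * R ^ n \<le> M + M'" for n
    using mult_right_mono[OF abs_triangle_ineq4[of "u n" "v n"], of "R ^ n"] R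
    by (smt (verit) distrib_right zero_less_power)
  then show "\<exists>M. \<forall>n. \<bar>u n - v n\<bar> * R ^ n \<le> M" by blast
qed

text \<open>Exponential tilting: multiplying by \<open>R ^ n\<close> gives, up to a constant, the
  Poisson law of parameter \<open>a * R\<close>.\<close>

lemma rapidly_decaying_poisson:
  assumes "a > 0"
  shows "rapidly_decaying (poisson a)"
  unfolding rapidly_decaying_def
proof (intro allI impI)
  fix R :: real assume R: "R > 0"
  have "\<bar>poisson a n\<bar> * R ^ n = poisson (a * R) n * exp (a * R - a)" for n
    using R assms by (simp add: poisson_def abs_mult power_mult_distrib exp_diff exp_minus field_simps)
  then have "\<bar>poisson a n\<bar> * R ^ n \<le> exp (a * R - a)" for n
    using poisson_le_1[of "a * R" n] R assms by simp
  then show "\<exists>M. \<forall>n. \<bar>poisson a n\<bar> * R ^ n \<le> M" by blast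
qed

lemma rapidly_decaying_weighted_l2:
  assumes a: "a > 0" and s: "summable (\<lambda>n. (u n)\<^sup>2 / poisson a n)"
  shows "rapidly_decaying u"
  unfolding rapidly_decaying_def
proof (intro allI impI)
  fix R :: real assume R: "R > 0"
  obtain M where M: "\<And>n. \<bar>poisson a n\<bar> * (R\<^sup>2) ^ n \<le> M"
    using rapidly_decaying_poisson[OF a] R unfolding rapidly_decaying_def by (metis zero_less_power)
  define S where "S = (\<Sum>n. (u n)\<^sup>2 / poisson a n)"
  have "\<bar>u n\<bar> * R ^ n \<le> S + M" for n
  proof -
    let ?p = "poisson a n"
    have p: "?p > 0" by (rule poisson_pos[OF a])
    have 1: "(u n)\<^sup>2 / ?p \<le> S"
      using sum_le_suminf[OF s, of "{n}"] poisson_pos[OF a] by (simp add: S_def less_imp_le)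
    have 2: "?p * (R\<^sup>2) ^ n \<le> M" using M[of n] p by simp
    \<comment> \<open>AM-GM between \<open>(u n)^2 / ?p\<close> and \<open>?p * R ^ (2 * n)\<close>,
      both already bounded.\<close>
    have "0 \<le> (\<bar>u n\<bar> - ?p * R ^ n)\<^sup>2 / ?p" using p by simp
    also have "\<dots> = (u n)\<^sup>2 / ?p + ?p * (R\<^sup>2) ^ n - 2 * (\<bar>u n\<bar> * R ^ n)"
      using p by (simp add: power2_eq_square power_mult_distrib field_simps)
    finally have "2 * (\<bar>u n\<bar> * R ^ n) \<le> S + M" using 1 2 by simp
    moreover have "\<bar>u n\<bar> * R ^ n \<ge> 0" using R by simp
    ultimately show ?thesis by linarith
  qed
  then show "\<exists>M. \<forall>n. \<bar>u n\<bar> * R ^ n \<le> M" by blast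
qed

section \<open>Bessel's inequality, pointwise reconstruction, completeness\<close>

lemma summable_charlier_coeff:
  assumes "a > 0" "rapidly_decaying u"
  shows "summable (\<lambda>n. u n * charlier a k n)"
  by (rule rapidly_decaying_summable[OF assms(2) charlier_bound]) (use assms in auto)

text \<open>For fixed \<open>K\<close>, let the truncation \<open>N\<close> tend to infinity in the
  finite Parseval inequality.\<close>

lemma charlier_bessel:
  assumes a: "a > 0" and s: "summable (\<lambda>n. (u n)\<^sup>2 / poisson a n)"
  shows "(\<Sum>k<K. charlier_weight a k * (charlier_coeff a u k)\<^sup>2) \<le> (\<Sum>n. (u n)\<^sup>2 / poisson a n)"
proof (rule LIMSEQ_le_const2)
  show "(\<lambda>N. \<Sum>k<K. charlier_weight a k * (\<Sum>n<N. u n * charlier a k n)\<^sup>2)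
      \<longlonglongrightarrow> (\<Sum>k<K. charlier_weight a k * (charlier_coeff a u k)\<^sup>2)"
    unfolding charlier_coeff_def
    by (intro tendsto_sum tendsto_mult tendsto_const tendsto_power summable_LIMSEQ
        summable_charlier_coeff a rapidly_decaying_weighted_l2[OF a s])
  have "(\<Sum>n<N. (u n)\<^sup>2 / poisson a n) \<le> (\<Sum>n. (u n)\<^sup>2 / poisson a n)" for N
    by (rule sum_le_suminf[OF s]) (use poisson_pos[OF a] in \<open>auto simp: less_imp_le\<close>)
  then show "\<exists>N0. \<forall>N\<ge>N0. (\<Sum>k<K. charlier_weight a k * (\<Sum>n<N. u n * charlier a k n)\<^sup>2)
      \<le> (\<Sum>n. (u n)\<^sup>2 / poisson a n)"
    using charlier_finite_parseval[OF a] order_trans by blast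
qed

text \<open>The partial kernels \<open>?B K\<close> tend to a point mass at \<open>m\<close> of
  height \<open>1 / poisson a m\<close>. Tannery's theorem, with a majorant uniform in
  \<open>K\<close>, carries the limit through the sum over \<open>n\<close>.\<close>

lemma charlier_reconstruction:
  assumes a: "a > 0" and u: "rapidly_decaying u"
  shows "(\<lambda>k. charlier_weight a k * charlier_coeff a u k * charlier a k m) sums (u m / poisson a m)"
proof -
  let ?B = "\<lambda>K n. \<Sum>k<K. charlier_weight a k * charlier a k m * charlier a k n"
  define r where "r = (a + real m) / a"
  have r: "r > 0" using a by (simp add: r_def add_pos_nonneg)
  have bound: "\<bar>?B K n\<bar> \<le> exp (a * r) * (1 + r) ^ n" for K n
    using charlier_kernel_abs(2)[OF a r_def, of n K] charlier_weight_pos[OF a]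
    by (intro order_trans[OF sum_abs]) (simp add: abs_mult less_imp_le abs_of_pos)
  obtain M where M: "\<And>n. \<bar>u n\<bar> * (2 * (1 + r)) ^ n \<le> M"
    using u r unfolding rapidly_decaying_def by (metis add_pos_pos mult_pos_pos zero_less_numeral zero_less_one)
  have "(\<lambda>K. \<Sum>n. u n * ?B K n) \<longlonglongrightarrow> (\<Sum>n. u n * (if m = n then 1 / poisson a m else 0))"
  proof (rule tannerys_theorem[THEN conjunct2, THEN conjunct2])
    show "(\<lambda>K. u n * ?B K n) \<longlonglongrightarrow> u n * (if m = n then 1 / poisson a m else 0)" for n
      using charlier_kernel[OF a, of m n] unfolding sums_def by (intro tendsto_mult tendsto_const) auto
    show "\<forall>\<^sub>F (n, K) in at_top \<times>\<^sub>F sequentially. norm (u n * ?B K n) \<le> exp (a * r) * M * (1 / 2) ^ n"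
      using geometric_majorant[OF M bound] r by (intro always_eventually) auto
  qed (auto intro: summable_half)
  also have "(\<Sum>n. u n * (if m = n then 1 / poisson a m else 0)) = u m / poisson a m"
    using suminf_finite[of "{m}" "\<lambda>n. u n * (if m = n then 1 / poisson a m else 0)"] by auto
  also have "(\<lambda>K. \<Sum>n. u n * ?B K n) = (\<lambda>K. \<Sum>k<K. charlier_weight a k * charlier_coeff a u k * charlier a k m)"
  proof
    fix K
    have "(\<lambda>n. \<Sum>k<K. charlier_weight a k * charlier a k m * (u n * charlier a k n)) sums
        (\<Sum>k<K. charlier_weight a k * charlier a k m * charlier_coeff a u k)"
      unfolding charlier_coeff_def
      by (intro sums_sum sums_mult summable_sums summable_charlier_coeff a u)
    then show "(\<Sum>n. u n * ?B K n) = (\<Sum>k<K. charlier_weight a k * charlier_coeff a u k * charlier a k m)"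
      by (simp add: sums_iff sum_distrib_left mult_ac)
  qed
  finally show ?thesis by (simp add: sums_def)
qed

text \<open>Duality: pairing the reconstruction of \<open>u\<close> with its truncation expresses
  the truncated norm \<open>V\<close> through the coefficients of both. Young's inequality and
  finite Parseval give \<open>V \<le> (B + V) / 2\<close>, hence \<open>V \<le> B\<close>.\<close>

lemma charlier_complete:
  assumes a: "a > 0" and u: "rapidly_decaying u"
    and B: "\<And>K. (\<Sum>k<K. charlier_weight a k * (charlier_coeff a u k)\<^sup>2) \<le> B"
  shows "summable (\<lambda>n. (u n)\<^sup>2 / poisson a n)" "(\<Sum>n. (u n)\<^sup>2 / poisson a n) \<le> B"
proof -
  let ?w = "charlier_weight a"
  have le: "(\<Sum>n<N. (u n)\<^sup>2 / poisson a n) \<le> B" for N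
  proof -
    define v where "v k = (\<Sum>n<N. u n * charlier a k n)" for k
    define V where "V = (\<Sum>n<N. (u n)\<^sup>2 / poisson a n)"
    have "(\<lambda>k. \<Sum>n<N. u n * (?w k * charlier_coeff a u k * charlier a k n)) sums
        (\<Sum>n<N. u n * (u n / poisson a n))"
      by (intro sums_sum sums_mult charlier_reconstruction a u)
    then have lim: "(\<lambda>K. \<Sum>k<K. ?w k * charlier_coeff a u k * v k) \<longlonglongrightarrow> V"
      by (simp add: sums_def v_def V_def sum_distrib_left mult_ac power2_eq_square)
    have "(\<Sum>k<K. ?w k * charlier_coeff a u k * v k) \<le> (B + V) / 2" for K
    proof -
      have "(\<Sum>k<K. ?w k * charlier_coeff a u k * v k)
          \<le> (\<Sum>k<K. (?w k * (charlier_coeff a u k)\<^sup>2 + ?w k * (v k)\<^sup>2) / 2)"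
      proof (rule sum_mono)
        fix k
        have "0 \<le> ?w k * (charlier_coeff a u k - v k)\<^sup>2"
          using charlier_weight_pos[OF a, of k] by simp
        then show "?w k * charlier_coeff a u k * v k
            \<le> (?w k * (charlier_coeff a u k)\<^sup>2 + ?w k * (v k)\<^sup>2) / 2"
          by (simp add: power2_eq_square algebra_simps)
      qed
      also have "\<dots> = ((\<Sum>k<K. ?w k * (charlier_coeff a u k)\<^sup>2) + (\<Sum>k<K. ?w k * (v k)\<^sup>2)) / 2"
        by (simp add: sum.distrib flip: sum_divide_distrib)
      also have "\<dots> \<le> (B + V) / 2"
        using B charlier_finite_parseval[OF a, of u N K] unfolding v_def V_def
        by (intro divide_right_mono add_mono) auto
      finally show ?thesis .
    qed
    then have "V \<le> (B + V) / 2" by (intro LIMSEQ_le_const2[OF lim]) auto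
    then show ?thesis by (simp add: V_def)
  qed
  have nonneg: "(u n)\<^sup>2 / poisson a n \<ge> 0" for n using poisson_pos[OF a, of n] by simp
  show *: "summable (\<lambda>n. (u n)\<^sup>2 / poisson a n)"
    by (rule summableI_nonneg_bounded[OF nonneg le])
  show "(\<Sum>n. (u n)\<^sup>2 / poisson a n) \<le> B"
    by (rule suminf_le_const[OF * le])
qed

text \<open>Orthogonality to the constant polynomial, from \<open>charlier_rec\<close> and the
  identity \<open>n * poisson a n = a * poisson a (n - 1)\<close> for
  \<open>n \<ge> 1\<close>.\<close>

lemma charlier_coeff_poisson:
  assumes a: "a > 0"
  shows "charlier_coeff a (poisson a) k = (if k = 0 then 1 else 0)"
proof (cases k)
  case 0
  then show ?thesis using poisson_sums[of a] by (simp add: charlier_coeff_def sums_iff)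
next
  case (Suc j)
  let ?f = "\<lambda>n. poisson a n * charlier a j n"
  have f: "?f sums suminf ?f"
    by (intro summable_sums summable_charlier_coeff rapidly_decaying_poisson a)
  have "(\<lambda>n. real (Suc n) * poisson a (Suc n) * charlier a j (Suc n - 1)) sums (a * suminf ?f)"
  proof -
    have "real (Suc n) * poisson a (Suc n) * charlier a j (Suc n - 1) = a * ?f n" for n
      by (simp add: poisson_def divide_simps)
    then show ?thesis using sums_mult[OF f, of a] by presburger
  qed
  then have "(\<lambda>n. real n * poisson a n * charlier a j (n - 1)) sums (a * suminf ?f)"
    by (subst (asm) sums_Suc_iff) simp
  from sums_diff[OF this sums_mult[OF f, of a]]
  have "(\<lambda>n. poisson a n * ((real j + 1) * charlier a (Suc j) n)) sums 0"
    unfolding charlier_rec by (simp add: algebra_simps)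
  from sums_mult[OF this, of "1 / (real j + 1)"]
  have "(\<lambda>n. poisson a n * charlier a (Suc j) n) sums 0"
    by (simp add: add_nonneg_eq_0_iff)
  then show ?thesis by (simp add: charlier_coeff_def sums_iff Suc)
qed

subsection \<open>Tails of the solution\<close>

text \<open>Derivatives relative to the interval suffice, so the one-sided derivative at time 0 is
  covered.\<close>

lemma nonincreasing_within:
  fixes f f' :: "real \<Rightarrow> real"
  assumes "0 \<le> \<tau>"
    and der: "\<And>t. t \<in> {0..\<tau>} \<Longrightarrow> (f has_real_derivative f' t) (at t within {0..\<tau>})"
    and le: "\<And>t. t \<in> {0..\<tau>} \<Longrightarrow> f' t \<le> 0"
  shows "f \<tau> \<le> f 0"
proof (rule DERIV_nonpos_imp_decreasing_open[OF assms(1)])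
  show "continuous_on {0..\<tau>} f"
    by (intro continuous_on_vector_derivative[of _ f f'])
      (use der in \<open>simp add: has_real_derivative_iff_has_vector_derivative\<close>)
  show "\<exists>y. DERIV f t :> y \<and> y \<le> 0" if "0 < t" "t < \<tau>" for t
    using der[of t] le[of t] that by (auto simp: at_within_Icc_at)
qed

locale ode_solution =
  fixes \<mu> a :: real and p :: "real \<Rightarrow> nat \<Rightarrow> real"
  assumes a_pos: "a > 0" and a_def: "a = \<mu> - 1" and sol: "is_solution \<mu> p"
begin

lemma p_nonneg: "t \<ge> 0 \<Longrightarrow> p t n \<ge> 0"
  using sol by (simp add: is_solution_def S_space_def)

lemma p_sums: "t \<ge> 0 \<Longrightarrow> p t sums 1"
  using sol by (simp add: is_solution_def S_space_def)

lemma p_sum_le: 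
  assumes "t \<ge> 0" "finite A" 
  shows "sum (p t) A \<le> 1"
  using sum_le_suminf[of "p t" A] assms p_sums[of t] p_nonneg by (simp add: sums_iff)

lemma p_le_1: "t \<ge> 0 \<Longrightarrow> p t n \<le> 1"
  using p_sum_le[of t "{n}"] by simp

lemma p_0_deriv:
  assumes "t \<in> {0..\<tau>}"
  shows "((\<lambda>s. p s 0) has_real_derivative - (a + p t 0) * p t 0) (at t within {0..\<tau>})"
  by (rule DERIV_subset[of _ _ _ "{0..}"]) (use sol assms in \<open>auto simp: is_solution_def a_def\<close>)

lemma p_Suc_deriv:
  assumes "t \<in> {0..\<tau>}"
  shows "((\<lambda>s. p s (Suc n)) has_real_derivative
    real (Suc n) * p t (Suc (Suc n)) + (a + p t 0) * p t n - real n * p t (Suc n) - (a + p t 0) * p t (Suc n))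
    (at t within {0..\<tau>})"
proof (rule DERIV_subset[of _ _ _ "{0..}"])
  have "\<forall>t\<ge>0. \<forall>n\<ge>1. ((\<lambda>s. p s n) has_real_derivative
        (real n * p t (n + 1) + (\<mu> - 1 + p t 0) * p t (n - 1)
         - (real n - 1) * p t n - (\<mu> - 1 + p t 0) * p t n)) (at t within {0..})"
    using sol by (simp add: is_solution_def)
  from this[rule_format, of t "Suc n"] show "((\<lambda>s. p s (Suc n)) has_real_derivative
    real (Suc n) * p t (Suc (Suc n)) + (a + p t 0) * p t n - real n * p t (Suc n) - (a + p t 0) * p t (Suc n))
    (at t within {0..})"
    using assms by (simp add: a_def)
qed auto

text \<open>With the factor \<open>exp (a * t)\<close> only the quadratic loss remains in the
  derivative.\<close>

lemma p_0_decay: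
  assumes "t \<ge> 0"
  shows "p t 0 \<le> exp (- a * t)"
proof -
  have "p t 0 * exp (a * t) \<le> p 0 0 * exp (a * 0)"
  proof (rule nonincreasing_within[OF assms])
    fix s assume s: "s \<in> {0..t}"
    show "((\<lambda>s. p s 0 * exp (a * s)) has_real_derivative - (p s 0)\<^sup>2 * exp (a * s)) (at s within {0..t})"
      by (rule derivative_eq_intros p_0_deriv[OF s] refl)+ (simp add: algebra_simps power2_eq_square)
  qed (simp add: mult_nonneg_nonneg)
  also have "\<dots> \<le> 1" using p_le_1[of 0 0] by simp
  finally show ?thesis by (simp add: exp_minus field_simps)
qed

text \<open>By total mass this is the sum over \<open>m > n\<close>; written as a complement it is
  differentiated as a finite sum.\<close>

definition tail :: "nat \<Rightarrow> real \<Rightarrow> real" where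
  "tail n t = 1 - (\<Sum>m\<le>n. p t m)"

lemma p_le_tail: "t \<ge> 0 \<Longrightarrow> p t (Suc n) \<le> tail n t"
  using p_sum_le[of t "{..Suc n}"] by (simp add: tail_def)

text \<open>Summing the equations telescopes to the net flux from level \<open>n\<close> to level
  \<open>n + 1\<close>.\<close>

lemma tail_deriv:
  assumes "t \<in> {0..\<tau>}"
  shows "(tail n has_real_derivative (a + p t 0) * p t n - real n * p t (Suc n)) (at t within {0..\<tau>})"
proof (induction n)
  case 0
  show ?case unfolding tail_def
    by (rule derivative_eq_intros p_0_deriv[OF assms] refl | simp add: algebra_simps)+
next
  case (Suc n)
  have "tail (Suc n) = (\<lambda>t. tail n t - p t (Suc n))" by (simp add: tail_def fun_eq_iff)
  then show ?case 
    by (simp only:) (rule derivative_eq_intros Suc p_Suc_deriv[OF assms] refl | simp add: algebra_simps)+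
qed

text \<open>Decay at rate \<open>2 * R\<close> is spent twice: on the weight \<open>R ^ n\<close>
  and on a factor \<open>(1 / 2) ^ n\<close> that makes the weighted tails summable.\<close>

lemma tail_initial:
  assumes "R \<ge> 1" and M: "\<And>n. p 0 (Suc n) * (2 * R) ^ n \<le> M"
  shows "tail n 0 * R ^ n \<le> 2 * M * (1 / 2) ^ n"
proof -
  have M0: "M \<ge> 0" using M[of 0] p_nonneg[of 0 "Suc 0"] by simp
  have q: "p 0 (Suc n) \<le> M * (1 / (2 * R)) ^ n" for n
    using M[of n] assms(1) by (simp add: field_simps)
  have R: "1 / (2 * R) \<le> 1 / 2" using assms(1) by simp
  have bd: "p 0 (m + Suc n) \<le> M * (1 / (2 * R)) ^ n * (1 / 2) ^ m" for m
  proof -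
    have "p 0 (m + Suc n) \<le> M * (1 / (2 * R)) ^ (m + n)" using q[of "m + n"] by simp
    also have "\<dots> = M * (1 / (2 * R)) ^ n * (1 / (2 * R)) ^ m" by (simp add: power_add)
    also have "\<dots> \<le> M * (1 / (2 * R)) ^ n * (1 / 2) ^ m"
      using R assms(1) M0 by (intro mult_left_mono power_mono) auto
    finally show ?thesis .
  qed
  have "(\<lambda>m. p 0 (m + Suc n)) sums (1 - (\<Sum>m<Suc n. p 0 m))"
    using p_sums[of 0] by (subst sums_iff_shift) simp
  then have tail_sums: "(\<lambda>m. p 0 (m + Suc n)) sums tail n 0"
    by (simp add: tail_def lessThan_Suc_atMost)
  have geometric: "(\<lambda>m. M * (1 / (2 * R)) ^ n * (1 / 2) ^ m) sums (M * (1 / (2 * R)) ^ n * 2)"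
    using sums_mult[OF geometric_sums[of "1 / 2 :: real"]] by simp
  have "tail n 0 \<le> M * (1 / (2 * R)) ^ n * 2"
    by (rule sums_le[OF bd tail_sums geometric])
  then have "tail n 0 * R ^ n \<le> M * (1 / (2 * R)) ^ n * 2 * R ^ n"
    using assms(1) by (intro mult_right_mono) auto
  also have "\<dots> = 2 * M * (1 / 2) ^ n"
    using assms(1) by (simp add: power_mult_distrib power_divide)
  finally show ?thesis .
qed

text \<open>Gronwall for the truncated weighted tail sum \<open>Y\<close>. The loss term is dropped
  and \<open>p_le_tail\<close> bounds each gain by the preceding tail, so the estimate closes on
  \<open>Y\<close> with constants independent of the truncation \<open>n\<close>.\<close>

lemma geometric_decay_propagates:
  assumes q0: "rapidly_decaying (\<lambda>n. p 0 (Suc n))" and R: "R \<ge> 1" and \<tau>: "\<tau> \<ge> 0"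
  shows "\<exists>M. \<forall>t\<in>{0..\<tau>}. \<forall>n. p t (Suc n) * R ^ n \<le> M"
proof -
  obtain M where M: "\<And>n. p 0 (Suc n) * (2 * R) ^ n \<le> M"
    using q0 R unfolding rapidly_decaying_def
    by (metis abs_of_nonneg order_refl p_nonneg mult_pos_pos zero_less_numeral less_le_trans zero_less_one)
  have M0: "M \<ge> 0" using M[of 0] p_nonneg[of 0 "Suc 0"] by simp
  define \<kappa> where "\<kappa> = (a + 1) * R"
  have \<kappa>: "\<kappa> \<ge> 0" using a_pos R by (simp add: \<kappa>_def)
  have "p t (Suc n) * R ^ n \<le> (4 * M + 1) * exp (\<kappa> * \<tau>)" if t: "t \<in> {0..\<tau>}" for t n
  proof -
    define Y where "Y s = (\<Sum>m\<le>n. tail m s * R ^ m)" for s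
    define Y' where "Y' s = (\<Sum>m\<le>n. ((a + p s 0) * p s m - real m * p s (Suc m)) * R ^ m)" for s
    have Y: "(Y has_real_derivative Y' s) (at s within {0..t})" if "s \<in> {0..t}" for s
      unfolding Y_def Y'_def by (intro DERIV_sum DERIV_cmult_right tail_deriv that)
    have tail_nonneg: "tail m s * R ^ m \<ge> 0" if "s \<ge> 0" for m s
      using p_nonneg[OF that, of "Suc m"] p_le_tail[OF that, of m] R by simp
    have Y'_le: "Y' s \<le> \<kappa> * (Y s + 1)" if "s \<in> {0..t}" for s
    proof -
      have s: "s \<ge> 0" using that by simp
      have "Y' s \<le> (\<Sum>m\<le>n. (a + 1) * (p s m * R ^ m))" unfolding Y'_def
      proof (rule sum_mono)
        fix m
        have "(a + p s 0) * p s m - real m * p s (Suc m) \<le> (a + 1) * p s m"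
          using mult_right_mono[of "a + p s 0" "a + 1" "p s m"] p_le_1[OF s, of 0] p_nonneg[OF s, of m]
            mult_nonneg_nonneg[OF of_nat_0_le_iff p_nonneg[OF s], of m "Suc m"]
          by linarith
        then show "((a + p s 0) * p s m - real m * p s (Suc m)) * R ^ m \<le> (a + 1) * (p s m * R ^ m)"
          using R mult_right_mono[of _ "(a + 1) * p s m" "R ^ m"] by (simp add: mult.assoc)
      qed
      also have "\<dots> = (a + 1) * (\<Sum>m\<le>n. p s m * R ^ m)" by (simp add: sum_distrib_left)
      \<comment> \<open>\<open>p s 0\<close> is split off, since no tail precedes it; the shift of
        the others costs one factor \<open>R\<close>.\<close>
      also have "(\<Sum>m\<le>n. p s m * R ^ m) = p s 0 + (\<Sum>m<n. p s (Suc m) * R ^ Suc m)"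
        by (simp add: sum.atMost_shift)
      also have "(\<Sum>m<n. p s (Suc m) * R ^ Suc m) \<le> (\<Sum>m<n. R * (tail m s * R ^ m))"
        using mult_right_mono[OF p_le_tail[OF s], of "R * R ^ _"] R by (intro sum_mono) (simp add: mult_ac)
      also have "\<dots> = R * (\<Sum>m<n. tail m s * R ^ m)" by (simp add: sum_distrib_left)
      also have "\<dots> \<le> R * Y s" unfolding Y_def
        using R tail_nonneg[OF s] by (intro mult_left_mono sum_mono2) auto
      also have "p s 0 + R * Y s \<le> R * (Y s + 1)"
        using p_le_1[OF s, of 0] R by (simp add: algebra_simps)
      finally show ?thesis using a_pos by (simp add: \<kappa>_def mult_ac)
    qed
    have "(Y t + 1) * exp (- \<kappa> * t) \<le> (Y 0 + 1) * exp (- \<kappa> * 0)"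
    proof (rule nonincreasing_within)
      show "t \<ge> 0" using t by simp
      show "((\<lambda>s. (Y s + 1) * exp (- \<kappa> * s)) has_real_derivative
          (Y' s - \<kappa> * (Y s + 1)) * exp (- \<kappa> * s)) (at s within {0..t})" if "s \<in> {0..t}" for s
        by (rule derivative_eq_intros Y[OF that] refl)+ (simp add: algebra_simps)
      show "(Y' s - \<kappa> * (Y s + 1)) * exp (- \<kappa> * s) \<le> 0" if "s \<in> {0..t}" for s
        using Y'_le[OF that] by (simp add: mult_nonpos_nonneg)
    qed
    moreover have "Y 0 \<le> 4 * M"
    proof -
      have "Y 0 \<le> (\<Sum>m<Suc n. 2 * M * (1 / 2) ^ m)"
        unfolding Y_def lessThan_Suc_atMost by (intro sum_mono tail_initial R M)
      also have "\<dots> \<le> (\<Sum>m. 2 * M * (1 / 2) ^ m)" using M0 by (intro sum_le_suminf summable_half) auto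
      also have "\<dots> = 4 * M"
        using sums_mult[OF geometric_sums[of "1 / 2 :: real"], of "2 * M"] by (simp add: sums_iff)
      finally show ?thesis .
    qed
    ultimately have "(Y t + 1) * exp (- \<kappa> * t) \<le> 4 * M + 1" by simp
    then have "Y t + 1 \<le> (4 * M + 1) * exp (\<kappa> * t)"
      by (simp add: exp_minus field_simps)
    also have "\<dots> \<le> (4 * M + 1) * exp (\<kappa> * \<tau>)"
      using M0 t \<kappa> by (intro mult_left_mono) (auto intro: mult_left_mono)
    finally have "Y t \<le> (4 * M + 1) * exp (\<kappa> * \<tau>)" by simp
    moreover have "tail n t * R ^ n \<le> Y t"
      unfolding Y_def using tail_nonneg t by (intro member_le_sum) auto
    moreover have "p t (Suc n) * R ^ n \<le> tail n t * R ^ n"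
      using p_le_tail t R by (intro mult_right_mono) auto
    ultimately show ?thesis by linarith
  qed
  then show ?thesis by blast
qed

end

subsection \<open>The Charlier coefficients of the solution\<close>

locale ode_solution_H = ode_solution +
  assumes summable_initial: "summable (\<lambda>n. (p 0 (Suc n))\<^sup>2 / poisson a n)"
begin

lemma p_geometric_bound:
  assumes "R \<ge> 1" "\<tau> \<ge> 0"
  obtains M where "\<And>t n. t \<in> {0..\<tau>} \<Longrightarrow> p t (Suc n) * R ^ n \<le> M"
  using geometric_decay_propagates[OF rapidly_decaying_weighted_l2[OF a_pos summable_initial] assms] by blast

lemma rapidly_decaying_solution:
  assumes "t \<ge> 0"
  shows "rapidly_decaying (\<lambda>n. p t (Suc n))"
  unfolding rapidly_decaying_def
proof (intro allI impI)
  fix R :: real assume R: "R > 0"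
  \<comment> \<open>Propagation requires a rate of at least 1; smaller \<open>R\<close> follow by
    monotonicity.\<close>
  obtain M where M: "\<And>s n. s \<in> {0..t} \<Longrightarrow> p s (Suc n) * (max 1 R) ^ n \<le> M"
    using p_geometric_bound[of "max 1 R" t] assms by auto
  have "\<bar>p t (Suc n)\<bar> * R ^ n \<le> p t (Suc n) * (max 1 R) ^ n" for n
    using p_nonneg[OF assms] R by (auto intro!: mult_left_mono power_mono)
  then show "\<exists>M. \<forall>n. \<bar>p t (Suc n)\<bar> * R ^ n \<le> M"
    using M[of t] assms by (meson atLeastAtMost_iff order_refl order_trans)
qed

definition coeff :: "nat \<Rightarrow> real \<Rightarrow> real" where
  "coeff k t = charlier_coeff a (\<lambda>n. p t (Suc n)) k"

lemma coeff_sums: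
  assumes "t \<ge> 0"
  shows "(\<lambda>n. p t (Suc n) * charlier a k n) sums coeff k t"
  unfolding coeff_def charlier_coeff_def
  by (intro summable_sums summable_charlier_coeff a_pos rapidly_decaying_solution assms)

lemma coeff_0: "t \<ge> 0 \<Longrightarrow> coeff 0 t = 1 - p t 0"
  using coeff_sums[of t 0] p_sums[of t] sums_Suc_iff[of "p t" "1 - p t 0"] by (simp add: sums_iff)

text \<open>Summation by parts moves the queue generator onto the Charlier polynomial, an
  eigenfunction for constant arrival rate \<open>a\<close>. The surplus rate \<open>p t 0\<close>
  couples to mode \<open>k\<close>, and the boundary value at \<open>n = 0\<close> yields the
  source.\<close>

lemma coeff_ode_sums:
  assumes t: "t \<ge> 0"
  shows "(\<lambda>n. (real (Suc n) * p t (Suc (Suc n)) + (a + p t 0) * p t n - real n * p t (Suc n)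
      - (a + p t 0) * p t (Suc n)) * charlier a (Suc k) n) sums
    (- (real k + 1) * coeff (Suc k) t + p t 0 * coeff k t + (a + p t 0) * p t 0 * charlier a (Suc k) 0)"
proof -
  let ?e = "charlier a (Suc k)"
  \<comment> \<open>\<open>H\<close> and \<open>L\<close> are the death and birth fluxes tested
    against \<open>?e\<close>. Both tend to 0, so only their values at index 0 survive telescoping,
    and \<open>H 0 = 0\<close>.\<close>
  define H where "H n = p t (Suc n) * (real n * ?e (n - 1))" for n
  define L where "L n = p t n * ?e n" for n
  have "summable H" unfolding H_def
  proof (rule rapidly_decaying_summable[OF rapidly_decaying_solution[OF t]])
    fix n
    have "real n \<le> 2 ^ n" using of_nat_less_two_power[of n, where ?'a = real] by linarith
    moreover have "\<bar>?e (n - 1)\<bar> \<le> exp a * 2 ^ n"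
      by (rule order_trans[OF charlier_bound[OF a_pos]]) simp
    ultimately have "real n * \<bar>?e (n - 1)\<bar> \<le> 2 ^ n * (exp a * 2 ^ n)" by (intro mult_mono) auto
    then show "\<bar>real n * ?e (n - 1)\<bar> \<le> exp a * 4 ^ n"
      by (simp add: abs_mult mult_ac flip: power_mult_distrib)
  qed simp
  then have H: "H \<longlonglongrightarrow> 0" by (rule summable_LIMSEQ_zero)
  have "summable (\<lambda>n. L (Suc n))" unfolding L_def
    by (rule rapidly_decaying_summable[OF rapidly_decaying_solution[OF t], where A = "2 * exp a" and r = 2])
      (use charlier_bound[OF a_pos, of "Suc k" "Suc _"] in \<open>simp_all del: charlier.simps add: mult_ac\<close>)
  then have L: "L \<longlonglongrightarrow> 0" by (rule LIMSEQ_imp_Suc[OF summable_LIMSEQ_zero])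
  have "(\<lambda>n. (H (Suc n) - H n) + (a + p t 0) * (L n - L (Suc n))
      + (- (real k + 1)) * (p t (Suc n) * ?e n) + p t 0 * (p t (Suc n) * charlier a k n)) sums
      ((0 - H 0) + (a + p t 0) * (L 0 - 0) + (- (real k + 1)) * coeff (Suc k) t + p t 0 * coeff k t)"
    by (rule sums_add[OF sums_add[OF sums_add[OF telescope_sums[OF H] sums_mult[OF telescope_sums'[OF L]]]
        sums_mult[OF coeff_sums[OF t]]] sums_mult[OF coeff_sums[OF t]]])
  moreover have "(H (Suc n) - H n) + (a + p t 0) * (L n - L (Suc n))
      + (- (real k + 1)) * (p t (Suc n) * ?e n) + p t 0 * (p t (Suc n) * charlier a k n)
      = (real (Suc n) * p t (Suc (Suc n)) + (a + p t 0) * p t n - real n * p t (Suc n)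
      - (a + p t 0) * p t (Suc n)) * ?e n" for n
  proof -
    have 1: "real n * ?e n = real n * ?e (n - 1) + real n * charlier a k (n - 1)"
      by (cases n) (auto simp: algebra_simps)
    \<comment> \<open>The eigenvalue equation: by Pascal's rule \<open>charlier a k n\<close> is the
      forward difference of \<open>?e\<close> at \<open>n\<close>.\<close>
    have "a * charlier a k n + (real n * ?e (n - 1) - real n * ?e n) = - (real k + 1) * ?e n"
      using charlier_rec[of k a n] 1 by linarith
    then have 2: "p t (Suc n) * (- (real k + 1) * ?e n)
        = p t (Suc n) * (a * charlier a k n + (real n * ?e (n - 1) - real n * ?e n))" by simp
    have 3: "L (Suc n) = p t (Suc n) * ?e n + p t (Suc n) * charlier a k n"
      by (simp add: L_def algebra_simps)
    have 4: "H (Suc n) = p t (Suc (Suc n)) * (real (Suc n) * ?e n)" by (simp add: H_def)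
    show ?thesis using 2 unfolding 3 4 by (simp add: H_def L_def algebra_simps)
  qed
  moreover have "(0 - H 0) + (a + p t 0) * (L 0 - 0) + (- (real k + 1)) * coeff (Suc k) t + p t 0 * coeff k t
      = - (real k + 1) * coeff (Suc k) t + p t 0 * coeff k t + (a + p t 0) * p t 0 * ?e 0"
    by (simp add: H_def L_def del: charlier.simps)
  ultimately show ?thesis by (simp only:)
qed

text \<open>Term-by-term differentiation, justified by a Weierstrass majorant on the compact time
  interval.\<close>

lemma coeff_deriv:
  assumes t: "t \<in> {0..\<tau>}"
  shows "(coeff (Suc k) has_real_derivative
    - (real k + 1) * coeff (Suc k) t + p t 0 * coeff k t + (a + p t 0) * p t 0 * charlier a (Suc k) 0)
    (at t within {0..\<tau>})"
proof -
  let ?e = "charlier a (Suc k)"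
  define D where "D t n = real (Suc n) * p t (Suc (Suc n)) + (a + p t 0) * p t n - real n * p t (Suc n)
      - (a + p t 0) * p t (Suc n)" for t n
  have \<tau>: "\<tau> \<ge> 0" using t by simp
  \<comment> \<open>Rate 8 is 2 times 4: a factor \<open>2 ^ n\<close> absorbs the linear rates, and
    \<open>(2 * 2) ^ n\<close> is what \<open>geometric_majorant\<close> asks for against
    polynomials of growth \<open>2 ^ n\<close>.\<close>
  obtain M where M: "\<And>t n. t \<in> {0..\<tau>} \<Longrightarrow> p t (Suc n) * 8 ^ n \<le> M"
    using p_geometric_bound[of 8 \<tau>] \<tau> by auto
  \<comment> \<open>One bound for \<open>p s n * 8 ^ n\<close> at all \<open>n\<close>: the index
    shift costs 8, and the 1 covers \<open>n = 0\<close>.\<close>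
  define P where "P = 8 * M + 1"
  define A where "A = (2 + 2 * (a + 1)) * P"
  have bound: "\<bar>D s n\<bar> * (2 * 2) ^ n \<le> A" if s: "s \<in> {0..\<tau>}" for s n
  proof -
    have s0: "s \<ge> 0" using s by simp
    note nn = p_nonneg[OF s0]
    have M0: "M \<ge> 0" using M[OF s, of 0] nn[of "Suc 0"] by simp
    have P: "p s n * 8 ^ n \<le> P" for n
    proof (cases n)
      case 0
      then show ?thesis using p_le_1[OF s0, of 0] M0 by (simp add: P_def)
    next
      case (Suc j)
      then show ?thesis using M[OF s, of j] by (simp add: P_def)
    qed
    have P1: "p s (Suc n) * 8 ^ n \<le> P" "p s (Suc (Suc n)) * 8 ^ n \<le> P"
      using M[OF s, of n] M[OF s, of "Suc n"] M0 nn[of "Suc (Suc n)"] unfolding P_def by auto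
    have P0: "P \<ge> 0" using M0 by (simp add: P_def)
    have n: "real (Suc n) \<le> 2 ^ n"
      by (metis Suc_leI less_exp of_nat_le_iff of_nat_numeral of_nat_power)
    have x: "a + p s 0 \<le> a + 1" "0 \<le> a + p s 0" using p_le_1[OF s0, of 0] nn[of 0] a_pos by auto
    have "\<bar>D s n\<bar> \<le> real (Suc n) * p s (Suc (Suc n)) + (a + p s 0) * p s n + real n * p s (Suc n)
      + (a + p s 0) * p s (Suc n)"
      unfolding D_def using nn x
      by (smt (verit) mult_nonneg_nonneg of_nat_0_le_iff)
    then have "\<bar>D s n\<bar> * 8 ^ n \<le> (real (Suc n) * p s (Suc (Suc n)) + (a + p s 0) * p s n + real n * p s (Suc n)
      + (a + p s 0) * p s (Suc n)) * 8 ^ n"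
      by (intro mult_right_mono) auto
    also have "\<dots> = real (Suc n) * (p s (Suc (Suc n)) * 8 ^ n) + (a + p s 0) * (p s n * 8 ^ n)
      + real n * (p s (Suc n) * 8 ^ n) + (a + p s 0) * (p s (Suc n) * 8 ^ n)"
      by (simp add: algebra_simps)
    also have "\<dots> \<le> 2 ^ n * P + (a + 1) * P + 2 ^ n * P + (a + 1) * P"
      using n P P1 x nn P0 a_pos by (intro add_mono mult_mono) auto
    also have "\<dots> \<le> 2 ^ n * A"
    proof -
      have "(a + 1) * P * 1 \<le> (a + 1) * P * 2 ^ n"
        using P0 a_pos by (intro mult_left_mono) auto
      then show ?thesis by (simp add: A_def algebra_simps)
    qed
    finally have "2 ^ n * (\<bar>D s n\<bar> * 4 ^ n) \<le> 2 ^ n * A"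
      by (simp add: mult_ac flip: power_mult_distrib)
    then show ?thesis by simp
  qed
  have majorant: "norm (D s n * ?e n) \<le> exp a * A * (1 / 2) ^ n" if "s \<in> {0..\<tau>}" for s n
    using geometric_majorant[OF bound[OF that] charlier_bound[OF a_pos]] by simp
  have "\<exists>g. \<forall>s\<in>{0..\<tau>}. (\<lambda>n. p s (Suc n) * ?e n) sums g s \<and>
      (g has_real_derivative (\<Sum>n. D s n * ?e n)) (at s within {0..\<tau>})"
  proof (rule has_field_derivative_series)
    show "uniform_limit {0..\<tau>} (\<lambda>n s. \<Sum>i<n. D s i * ?e i) (\<lambda>s. \<Sum>n. D s n * ?e n) sequentially"
      by (rule Weierstrass_m_test[OF majorant summable_half])
    show "((\<lambda>s. p s (Suc n) * ?e n) has_real_derivative D s n * ?e n) (at s within {0..\<tau>})"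
      if "s \<in> {0..\<tau>}" for n s
      unfolding D_def by (intro DERIV_cmult_right p_Suc_deriv that)
    show "summable (\<lambda>n. p t (Suc n) * ?e n)"
      using coeff_sums[of t "Suc k"] t by (simp add: sums_iff)
  qed (use t in auto)
  then obtain g where g: "\<And>s. s \<in> {0..\<tau>} \<Longrightarrow> (\<lambda>n. p s (Suc n) * ?e n) sums g s"
      "(g has_real_derivative (\<Sum>n. D t n * ?e n)) (at t within {0..\<tau>})"
    using t by blast
  have "g s = coeff (Suc k) s" if "s \<in> {0..\<tau>}" for s
    using sums_unique2[OF coeff_sums g(1)[OF that]] that by simp
  then have "(coeff (Suc k) has_real_derivative (\<Sum>n. D t n * ?e n)) (at t within {0..\<tau>})"
    by (intro has_field_derivative_transform_within[OF g(2) zero_less_one t]) auto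
  then show ?thesis
    using coeff_ode_sums[of t k] t by (simp add: sums_iff D_def)
qed

end

subsection \<open>Energy estimate\<close>

context ode_solution_H
begin

text \<open>Mode 0 is left out because mass conservation fixes it as \<open>1 - p t 0\<close>, which
  does not tend to 0.\<close>

definition energy :: "nat \<Rightarrow> real \<Rightarrow> real" where
  "energy K t = (\<Sum>k<K. charlier_weight a (Suc k) * (coeff (Suc k) t)\<^sup>2)"

text \<open>One number dominating both the coefficient of the energy and the constant term in the
  estimate of \<open>energy_deriv\<close>.\<close>

definition energy_rate :: real where
  "energy_rate = 1 + 1 / a + (a + 1) + (a + 1) * exp a"

lemma energy_rate_nonneg: "energy_rate \<ge> 0"
  using a_pos by (simp add: energy_rate_def)

lemma energy_nonneg: "energy K t \<ge> 0"
  using charlier_weight_pos[OF a_pos] by (simp add: energy_def sum_nonneg less_imp_le)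

text \<open>Each mode couples only to the one below, so truncation produces no unknown higher term.
  Every perturbation carries a factor \<open>p t 0\<close>, which decays like
  \<open>exp (- a * t)\<close>.\<close>

lemma energy_deriv:
  assumes t: "t \<in> {0..\<tau>}"
  obtains E' where "(energy K has_real_derivative E') (at t within {0..\<tau>})"
    "E' \<le> - 2 * energy K t + energy_rate * exp (- a * t) * (energy K t + 1)"
proof
  let ?w = "charlier_weight a" and ?x = "p t 0"
  define c where "c k = coeff k t" for k
  define e where "e k = charlier a k 0" for k
  have t0: "t \<ge> 0" using t by simp
  have x: "0 \<le> ?x" "?x \<le> 1" using p_nonneg[OF t0] p_le_1[OF t0] by auto
  have w: "?w k \<ge> 0" for k using charlier_weight_pos[OF a_pos, of k] by simp
  define c' where "c' k = - (real k + 1) * c (Suc k) + ?x * c k + (a + ?x) * ?x * e (Suc k)" for k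
  define E' where "E' = (\<Sum>k<K. ?w (Suc k) * (2 * c (Suc k) * c' k))"
  show "(energy K has_real_derivative E') (at t within {0..\<tau>})"
    unfolding energy_def E'_def
  proof (intro DERIV_sum DERIV_cmult)
    fix k
    show "((\<lambda>t. (coeff (Suc k) t)\<^sup>2) has_real_derivative 2 * c (Suc k) * c' k) (at t within {0..\<tau>})"
      by (rule derivative_eq_intros coeff_deriv[OF t] refl)+ (simp add: c_def c'_def e_def del: charlier.simps)
  qed
  have mode: "?w (Suc k) * (2 * c (Suc k) * c' k) \<le> (- 2 + ?x + (a + 1) * ?x) * (?w (Suc k) * (c (Suc k))\<^sup>2)
      + ?x / a * (?w k * (c k)\<^sup>2) + (a + 1) * ?x * (?w (Suc k) * (e (Suc k))\<^sup>2)" for k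
  proof -
    let ?y = "c (Suc k)" and ?W = "?w (Suc k)" and ?f = "e (Suc k)"
    \<comment> \<open>Young's inequality scaled so that the cross term carries exactly
      \<open>?w (Suc k)\<close>.\<close>
    have "0 \<le> ?w k / a * ((real k + 1) * ?y - c k)\<^sup>2" using w[of k] a_pos by simp
    also have "\<dots> = (real k + 1) * ((real k + 1) / a * ?w k) * ?y\<^sup>2 + ?w k * (c k)\<^sup>2 / a
        - 2 * ((real k + 1) / a * ?w k) * ?y * c k"
      using a_pos by (simp add: power2_eq_square field_simps)
    finally have "2 * ?W * ?y * c k \<le> (real k + 1) * ?W * ?y\<^sup>2 + ?w k * (c k)\<^sup>2 / a"
      by (simp add: charlier_weight_Suc[OF a_pos])
    then have 1: "?x * (2 * ?W * ?y * c k) \<le> ?x * ((real k + 1) * ?W * ?y\<^sup>2 + ?w k * (c k)\<^sup>2 / a)"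
      using x by (intro mult_left_mono)
    have "0 \<le> ?W * (?y - ?f)\<^sup>2" using w[of "Suc k"] by simp
    also have "\<dots> = ?W * ?y\<^sup>2 + ?W * ?f\<^sup>2 - 2 * ?W * ?y * ?f" by (simp add: power2_eq_square algebra_simps)
    finally have "(a + ?x) * ?x * (2 * ?W * ?y * ?f) \<le> (a + ?x) * ?x * (?W * ?y\<^sup>2 + ?W * ?f\<^sup>2)"
      using x a_pos by (intro mult_left_mono) auto
    also have "\<dots> \<le> (a + 1) * ?x * (?W * ?y\<^sup>2 + ?W * ?f\<^sup>2)"
      using x a_pos w[of "Suc k"] by (intro mult_right_mono add_nonneg_nonneg) auto
    finally have 2: "(a + ?x) * ?x * (2 * ?W * ?y * ?f) \<le> (a + 1) * ?x * (?W * ?y\<^sup>2 + ?W * ?f\<^sup>2)" .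
    \<comment> \<open>As \<open>?x \<le> 1\<close>, the dissipation absorbs the part of the coupling
      growing with \<open>k\<close>; the rate 2 of the lowest mode remains.\<close>
    have "0 \<le> (2 - ?x) * real k * (?W * ?y\<^sup>2)" using x w[of "Suc k"] by simp
    then have 3: "- 2 * (real k + 1) * ?W * ?y\<^sup>2 + ?x * (real k + 1) * ?W * ?y\<^sup>2 \<le> (- 2 + ?x) * (?W * ?y\<^sup>2)"
      by (simp add: algebra_simps)
    have "?W * (2 * ?y * c' k) = - 2 * (real k + 1) * ?W * ?y\<^sup>2 + ?x * (2 * ?W * ?y * c k)
        + (a + ?x) * ?x * (2 * ?W * ?y * ?f)"
      unfolding c'_def by (simp add: power2_eq_square algebra_simps)
    also have "\<dots> \<le> (- 2 * (real k + 1) * ?W * ?y\<^sup>2 + ?x * (real k + 1) * ?W * ?y\<^sup>2) + ?x / a * (?w k * (c k)\<^sup>2)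
        + (a + 1) * ?x * (?W * ?y\<^sup>2 + ?W * ?f\<^sup>2)"
      using 1 2 by (simp add: algebra_simps)
    also have "\<dots> \<le> (- 2 + ?x) * (?W * ?y\<^sup>2) + ?x / a * (?w k * (c k)\<^sup>2)
        + (a + 1) * ?x * (?W * ?y\<^sup>2 + ?W * ?f\<^sup>2)"
      using 3 by simp
    finally show ?thesis by (simp add: algebra_simps)
  qed
  \<comment> \<open>Mode 0 contributes at most 1, and adding the term \<open>K\<close> completes
    \<open>energy K t\<close>.\<close>
  have low: "(\<Sum>k<K. ?w k * (c k)\<^sup>2) \<le> 1 + energy K t"
  proof -
    have "(\<Sum>k<K. ?w k * (c k)\<^sup>2) \<le> (\<Sum>k<Suc K. ?w k * (c k)\<^sup>2)" using w[of K] by simp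
    also have "\<dots> = (1 - ?x)\<^sup>2 + energy K t"
      unfolding sum.lessThan_Suc_shift energy_def c_def coeff_0[OF t0] by (simp add: charlier_weight_def)
    also have "(1 - ?x)\<^sup>2 \<le> 1" using x by (simp add: power_le_one)
    finally show ?thesis by simp
  qed
  have src: "(\<Sum>k<K. ?w (Suc k) * (e (Suc k))\<^sup>2) \<le> exp a"
  proof -
    have "(\<Sum>k<K. ?w (Suc k) * (e (Suc k))\<^sup>2) \<le> (\<Sum>k<Suc K. ?w k * (e k)\<^sup>2)"
      unfolding sum.lessThan_Suc_shift[of _ K] using w[of 0] by simp
    also have "\<dots> \<le> exp a"
      \<comment> \<open>Finite Parseval for the unit mass at 0, whose weighted square norm is
        \<open>exp a\<close>.\<close>
      using charlier_finite_parseval[OF a_pos, of "\<lambda>_. 1" 1 "Suc K"]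
      by (simp add: e_def poisson_def exp_minus inverse_eq_divide lessThan_Suc[of 0] del: charlier.simps sum.lessThan_Suc)
    finally show ?thesis .
  qed
  have "E' \<le> (\<Sum>k<K. (- 2 + ?x + (a + 1) * ?x) * (?w (Suc k) * (c (Suc k))\<^sup>2)
      + ?x / a * (?w k * (c k)\<^sup>2) + (a + 1) * ?x * (?w (Suc k) * (e (Suc k))\<^sup>2))"
    unfolding E'_def by (intro sum_mono mode)
  also have "\<dots> = (- 2 + ?x + (a + 1) * ?x) * energy K t
      + ?x / a * (\<Sum>k<K. ?w k * (c k)\<^sup>2) + (a + 1) * ?x * (\<Sum>k<K. ?w (Suc k) * (e (Suc k))\<^sup>2)"
    by (simp add: energy_def c_def sum.distrib sum_distrib_left)
  also have "\<dots> \<le> (- 2 + ?x + (a + 1) * ?x) * energy K t + ?x / a * (1 + energy K t) + (a + 1) * ?x * exp a"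
    using x a_pos low src by (intro add_mono mult_left_mono order_refl) auto
  also have "\<dots> = - 2 * energy K t + ?x * ((1 + 1 / a + (a + 1)) * energy K t + 1 / a + (a + 1) * exp a)"
    using a_pos by (simp add: field_simps)
  also have "\<dots> \<le> - 2 * energy K t + ?x * (energy_rate * (energy K t + 1))"
  proof -
    have "0 \<le> (a + 1) * exp a * energy K t" using a_pos energy_nonneg[of K t] by simp
    then have "(1 + 1 / a + (a + 1)) * energy K t + 1 / a + (a + 1) * exp a \<le> energy_rate * (energy K t + 1)"
      unfolding energy_rate_def using a_pos by (simp add: distrib_left distrib_right)
    then show ?thesis using x by (simp add: mult_left_mono)
  qed
  also have "\<dots> \<le> - 2 * energy K t + exp (- a * t) * (energy_rate * (energy K t + 1))"
    using p_0_decay[OF t0] energy_rate_nonneg energy_nonneg[of K t] by (intro add_left_mono mult_right_mono) auto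
  finally show "E' \<le> - 2 * energy K t + energy_rate * exp (- a * t) * (energy K t + 1)" by (simp add: mult_ac)
qed

text \<open>Gronwall with constants independent of \<open>K\<close>. The antiderivative
  \<open>J\<close> stays abstract because its form depends on whether \<open>a = 2\<close>.\<close>

lemma energy_bound:
  assumes \<tau>: "\<tau> \<ge> 0" and J: "\<And>t. (J has_real_derivative exp ((2 - a) * t)) (at t)"
  shows "energy K \<tau> * exp (2 * \<tau>) \<le> exp (energy_rate / a) * (energy K 0 + energy_rate * (J \<tau> - J 0))"
proof -
  define C where "C = energy_rate"
  have C: "C \<ge> 0" using energy_rate_nonneg by (simp add: C_def)
  \<comment> \<open>The integrating factor: its logarithmic derivative is
    \<open>2 - C * exp (- a * t)\<close>, and for \<open>t \<ge> 0\<close> it exceeds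
    \<open>exp (2 * t)\<close> by at most the factor \<open>exp (C / a)\<close>.\<close>
  define I where "I t = exp (2 * t + C / a * exp (- a * t))" for t
  define G where "G t = energy K t * I t - C * exp (C / a) * J t" for t
  \<comment> \<open>\<open>energy_deriv\<close> yields a derivative at each time separately; choice
    turns these into a function.\<close>
  define E' where "E' t = (SOME E'. (energy K has_real_derivative E') (at t within {0..\<tau>}) \<and>
    E' \<le> - 2 * energy K t + C * exp (- a * t) * (energy K t + 1))" for t
  have E': "(energy K has_real_derivative E' t) (at t within {0..\<tau>})"
      "E' t \<le> - 2 * energy K t + C * exp (- a * t) * (energy K t + 1)" if "t \<in> {0..\<tau>}" for t
  proof -
    from energy_deriv[OF that, of K] have "\<exists>E'. (energy K has_real_derivative E') (at t within {0..\<tau>}) \<and>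
      E' \<le> - 2 * energy K t + C * exp (- a * t) * (energy K t + 1)" unfolding C_def by metis
    from someI_ex[OF this] show "(energy K has_real_derivative E' t) (at t within {0..\<tau>})"
      "E' t \<le> - 2 * energy K t + C * exp (- a * t) * (energy K t + 1)" unfolding E'_def by blast+
  qed
  have I: "(I has_real_derivative I t * (2 - C * exp (- a * t))) (at t within {0..\<tau>})" for t
    unfolding I_def using a_pos by (auto intro!: derivative_eq_intros simp: field_simps)
  have I_le: "I t \<le> exp (C / a) * exp (2 * t)" if "t \<ge> 0" for t
  proof -
    have "exp (- a * t) \<le> 1" using a_pos that by simp
    then have "C / a * exp (- a * t) \<le> C / a * 1" using a_pos C by (intro mult_left_mono) auto
    then show ?thesis by (simp add: I_def flip: exp_add)
  qed
  have "G \<tau> \<le> G 0"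
  proof (rule nonincreasing_within[OF \<tau>])
    fix t assume t: "t \<in> {0..\<tau>}"
    show "(G has_real_derivative E' t * I t + energy K t * (I t * (2 - C * exp (- a * t)))
        - C * exp (C / a) * exp ((2 - a) * t)) (at t within {0..\<tau>})"
      unfolding G_def
      by (rule derivative_eq_intros E'(1)[OF t] I has_field_derivative_at_within[OF J] refl)+ simp
    have I0: "I t \<ge> 0" by (simp add: I_def)
    have "E' t * I t \<le> (- 2 * energy K t + C * exp (- a * t) * (energy K t + 1)) * I t"
      using E'(2)[OF t] I0 by (rule mult_right_mono)
    then have "E' t * I t + energy K t * (I t * (2 - C * exp (- a * t))) \<le> C * exp (- a * t) * I t"
      by (simp add: algebra_simps)
    also have "\<dots> \<le> C * exp (- a * t) * (exp (C / a) * exp (2 * t))"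
      using I_le[of t] t C by (intro mult_left_mono) auto
    also have "\<dots> = C * exp (C / a) * exp ((2 - a) * t)"
      by (simp add: algebra_simps flip: exp_add)
    finally show "E' t * I t + energy K t * (I t * (2 - C * exp (- a * t)))
        - C * exp (C / a) * exp ((2 - a) * t) \<le> 0" by simp
  qed
  then have "energy K \<tau> * I \<tau> \<le> exp (C / a) * (energy K 0 + C * (J \<tau> - J 0))"
    by (simp add: G_def I_def algebra_simps)
  moreover have "exp (2 * \<tau>) \<le> I \<tau>" using C a_pos by (simp add: I_def)
  then have "energy K \<tau> * exp (2 * \<tau>) \<le> energy K \<tau> * I \<tau>"
    using energy_nonneg by (rule mult_left_mono)
  ultimately show ?thesis by (simp add: C_def)
qed

section \<open>From the energy to the distance in the weighted space\<close>

definition initial_norm :: real where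
  "initial_norm = (\<Sum>n. (p 0 (Suc n))\<^sup>2 / poisson a n)"

lemma energy_initial: "energy K 0 \<le> initial_norm"
proof -
  have "energy K 0 \<le> (\<Sum>k<Suc K. charlier_weight a k * (coeff k 0)\<^sup>2)"
    unfolding sum.lessThan_Suc_shift[of _ K] energy_def using charlier_weight_pos[OF a_pos, of 0] by simp
  also have "\<dots> \<le> initial_norm"
    unfolding initial_norm_def coeff_def by (rule charlier_bessel[OF a_pos summable_initial])
  finally show ?thesis .
qed

lemma initial_norm_nonneg: "initial_norm \<ge> 0"
  using energy_initial[of 0] by (simp add: energy_def)

text \<open>The energy bound holds for every \<open>K\<close>, so completeness converts it into
  membership and a norm estimate.\<close>

lemma distance_bound:
  assumes t: "t \<ge> 0" and J: "\<And>t. (J has_real_derivative exp ((2 - a) * t)) (at t)"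
  shows "(\<lambda>n. p t n - pbar \<mu> n) \<in> H_space \<mu>"
    and "(H_norm \<mu> (\<lambda>n. p t n - pbar \<mu> n))\<^sup>2 \<le>
      2 * exp (- 2 * a * t) + exp (energy_rate / a) * (initial_norm + energy_rate * (J t - J 0)) * exp (- 2 * t)"
proof -
  define B where "B = exp (energy_rate / a) * (initial_norm + energy_rate * (J t - J 0)) * exp (- 2 * t)"
  define u where "u n = p t (Suc n) - poisson a n" for n
  have pbar: "pbar \<mu> (Suc n) = poisson a n" "pbar \<mu> 0 = 0" for n
    by (simp_all add: pbar_def poisson_def a_def)
  have B: "energy K t \<le> B" for K
  proof -
    have "energy K t * exp (2 * t) \<le> exp (energy_rate / a) * (energy K 0 + energy_rate * (J t - J 0))"
      by (rule energy_bound[OF t J])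
    also have "\<dots> \<le> exp (energy_rate / a) * (initial_norm + energy_rate * (J t - J 0))"
      using energy_initial by simp
    finally show ?thesis by (simp add: B_def exp_minus field_simps)
  qed
  have u: "rapidly_decaying u"
    unfolding u_def by (intro rapidly_decaying_diff rapidly_decaying_solution rapidly_decaying_poisson t a_pos)
  \<comment> \<open>Subtracting the Poisson law alters mode 0 only, which becomes
    \<open>- p t 0\<close>.\<close>
  have u_coeff: "charlier_coeff a u k = coeff k t - (if k = 0 then 1 else 0)" for k
  proof -
    have "(\<lambda>n. p t (Suc n) * charlier a k n - poisson a n * charlier a k n) sums
        (coeff k t - charlier_coeff a (poisson a) k)"
      unfolding charlier_coeff_def[of a "poisson a"]
      by (intro sums_diff coeff_sums t summable_sums summable_charlier_coeff a_pos rapidly_decaying_poisson)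
    then show ?thesis
      by (simp add: charlier_coeff_poisson[OF a_pos] charlier_coeff_def[of a u] u_def sums_iff left_diff_distrib)
  qed
  have bound: "(\<Sum>k<K. charlier_weight a k * (charlier_coeff a u k)\<^sup>2) \<le> (p t 0)\<^sup>2 + B" for K
  proof -
    have "(\<Sum>k<K. charlier_weight a k * (charlier_coeff a u k)\<^sup>2)
        \<le> (\<Sum>k<Suc K. charlier_weight a k * (charlier_coeff a u k)\<^sup>2)"
      using charlier_weight_pos[OF a_pos, of K] by simp
    also have "\<dots> = (p t 0)\<^sup>2 + energy K t"
      unfolding sum.lessThan_Suc_shift u_coeff energy_def by (simp add: coeff_0[OF t] charlier_weight_def)
    finally show ?thesis using B[of K] by simp
  qed
  note complete = charlier_complete[OF a_pos u bound]
  have "summable (\<lambda>n. (u n)\<^sup>2)"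
  proof (rule summable_comparison_test'[OF complete(1), of 0])
    fix n
    have "(u n)\<^sup>2 * poisson a n \<le> (u n)\<^sup>2 * 1"
      using poisson_le_1[OF a_pos] by (intro mult_left_mono) auto
    then show "norm ((u n)\<^sup>2) \<le> (u n)\<^sup>2 / poisson a n"
      using poisson_pos[OF a_pos, of n] by (simp add: field_simps)
  qed
  then have "summable (\<lambda>n. (p t n - pbar \<mu> n)\<^sup>2)"
    by (subst summable_Suc_iff[symmetric]) (simp add: pbar u_def)
  then show "(\<lambda>n. p t n - pbar \<mu> n) \<in> H_space \<mu>"
    using complete(1) by (simp add: H_space_def pbar u_def)
  have inner: "H_inner \<mu> (\<lambda>n. p t n - pbar \<mu> n) (\<lambda>n. p t n - pbar \<mu> n)
      = (p t 0)\<^sup>2 + (\<Sum>n. (u n)\<^sup>2 / poisson a n)"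
    by (simp add: H_inner_def pbar u_def power2_eq_square)
  have "0 \<le> (\<Sum>n. (u n)\<^sup>2 / poisson a n)"
    using complete(1) poisson_pos[OF a_pos] by (intro suminf_nonneg) (auto simp: less_imp_le)
  then have "(H_norm \<mu> (\<lambda>n. p t n - pbar \<mu> n))\<^sup>2 = (p t 0)\<^sup>2 + (\<Sum>n. (u n)\<^sup>2 / poisson a n)"
    by (simp add: H_norm_def inner)
  \<comment> \<open>The factor 2: \<open>p t 0\<close> enters as coordinate 0 and again as mode 0 of
    \<open>u\<close>.\<close>
  also have "\<dots> \<le> 2 * (p t 0)\<^sup>2 + B" using complete(2) by simp
  also have "(p t 0)\<^sup>2 \<le> (exp (- a * t))\<^sup>2"
    using p_0_decay[OF t] p_nonneg[OF t] by (rule power_mono)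
  also have "(exp (- a * t))\<^sup>2 = exp (- 2 * a * t)" by (simp flip: exp_double)
  finally show "(H_norm \<mu> (\<lambda>n. p t n - pbar \<mu> n))\<^sup>2 \<le> 2 * exp (- 2 * a * t)
      + exp (energy_rate / a) * (initial_norm + energy_rate * (J t - J 0)) * exp (- 2 * t)"
    by (simp add: B_def)
qed

end

text \<open>At \<open>t = 0\<close> a bare factor \<open>t\<close> would force
  \<open>p 0 = pbar \<mu>\<close>; \<open>max 1 t\<close> agrees with \<open>t\<close> from time 1
  on. Since \<open>pbar \<mu>\<close> lies in \<open>H_space \<mu>\<close>, the membership claimed
  at \<open>t = 0\<close> amounts to \<open>p 0 \<in> H_space \<mu>\<close>.\<close>

theorem theorem3:
  fixes \<mu> :: real and p :: "real \<Rightarrow> nat \<Rightarrow> real"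
  assumes "\<mu> > 1"
    and "is_solution \<mu> p"
    and "p 0 \<in> S_space \<mu>"
    and "p 0 \<in> H_space \<mu>"
  shows "\<exists>C>0. \<forall>t\<ge>0.
           (\<lambda>n. p t n - pbar \<mu> n) \<in> H_space \<mu> \<and>
           (H_norm \<mu> (\<lambda>n. p t n - pbar \<mu> n))\<^sup>2 \<le>
             (if \<mu> < 3 then C * max 1 t * exp (- (\<mu> - 1) * t)
              else if \<mu> = 3 then C * (max 1 t)\<^sup>2 * exp (- 2 * t)
              else C * exp (- 2 * t))"
proof -
  define a where "a = \<mu> - 1"
  interpret ode_solution_H \<mu> a p
  proof
    show "summable (\<lambda>n. (p 0 (Suc n))\<^sup>2 / poisson a n)"
      using assms(4) by (simp add: H_space_def pbar_def poisson_def a_def)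
  qed (use assms in \<open>auto simp: a_def\<close>)
  define A where "A = exp (energy_rate / a)"
  define N where "N = initial_norm"
  define R where "R = energy_rate"
  have ANR: "A \<ge> 0" "N \<ge> 0" "R \<ge> 0"
    using initial_norm_nonneg energy_rate_nonneg by (simp_all add: A_def N_def R_def)
  let ?u = "\<lambda>t n. p t n - pbar \<mu> n"
  \<comment> \<open>Only increments of \<open>J\<close> matter, so it is not normalised at 0;
    resonance at \<open>a = 2\<close> produces linear growth.\<close>
  define J where "J t = (if a = 2 then t else exp ((2 - a) * t) / (2 - a))" for t
  have J: "(J has_real_derivative exp ((2 - a) * t)) (at t)" for t
    unfolding J_def by (cases "a = 2") (auto intro!: derivative_eq_intros)
  note bound = distance_bound(2)[OF _ J, folded A_def N_def R_def]
  have reduce: ?thesis if "C > 0" and le: "\<And>t. t \<ge> 0 \<Longrightarrow> (H_norm \<mu> (?u t))\<^sup>2 \<le>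
             (if \<mu> < 3 then C * max 1 t * exp (- (\<mu> - 1) * t)
              else if \<mu> = 3 then C * (max 1 t)\<^sup>2 * exp (- 2 * t)
              else C * exp (- 2 * t))" for C
    using that distance_bound(1)[OF _ J] by blast
  consider "a < 2" | "a = 2" | "a > 2" by linarith
  then show ?thesis
  proof cases
    case 1
    \<comment> \<open>As \<open>a < 2\<close>, all terms are bounded by multiples of
      \<open>exp (- a * t)\<close>; \<open>C\<close> adds up the coefficients, and
      \<open>1 \<le> max 1 t\<close> gives the stated form.\<close>
    define C where "C = 2 + A * (N + R / (2 - a))"
    have C: "C > 0" using ANR 1 by (simp add: C_def add_pos_nonneg)
    show ?thesis
    proof (rule reduce[OF C])
      fix t :: real assume t: "t \<ge> 0"
      have "(H_norm \<mu> (?u t))\<^sup>2 \<le> 2 * exp (- 2 * a * t) + A * (N + R * (J t - J 0)) * exp (- 2 * t)"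
        by (rule bound[OF t])
      also have "\<dots> \<le> 2 * exp (- a * t) + A * (N * exp (- a * t) + R / (2 - a) * exp (- a * t))"
      proof (rule add_mono)
        show "2 * exp (- 2 * a * t) \<le> 2 * exp (- a * t)" using a_pos t by simp
        have "J t - J 0 \<le> exp ((2 - a) * t) / (2 - a)" using 1 by (simp add: J_def)
        then have "R * (J t - J 0) * exp (- 2 * t) \<le> R * (exp ((2 - a) * t) / (2 - a)) * exp (- 2 * t)"
          using ANR by (intro mult_right_mono mult_left_mono) auto
        also have "\<dots> = R / (2 - a) * exp (- a * t)" by (simp add: algebra_simps flip: exp_add)
        finally have R_le: "R * (J t - J 0) * exp (- 2 * t) \<le> R / (2 - a) * exp (- a * t)" .
        have N_le: "N * exp (- 2 * t) \<le> N * exp (- a * t)"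
          using 1 t ANR by (intro mult_left_mono) (auto intro: mult_right_mono)
        have "A * (N * exp (- 2 * t) + R * (J t - J 0) * exp (- 2 * t))
            \<le> A * (N * exp (- a * t) + R / (2 - a) * exp (- a * t))"
          by (rule mult_left_mono[OF add_mono[OF N_le R_le] ANR(1)])
        then show "A * (N + R * (J t - J 0)) * exp (- 2 * t)
            \<le> A * (N * exp (- a * t) + R / (2 - a) * exp (- a * t))"
          by (simp add: algebra_simps)
      qed
      also have "\<dots> = C * 1 * exp (- a * t)" by (simp add: C_def algebra_simps)
      also have "\<dots> \<le> C * max 1 t * exp (- a * t)" using C by (intro mult_right_mono mult_left_mono) auto
      finally show "(H_norm \<mu> (?u t))\<^sup>2 \<le> (if \<mu> < 3 then C * max 1 t * exp (- (\<mu> - 1) * t)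
              else if \<mu> = 3 then C * (max 1 t)\<^sup>2 * exp (- 2 * t) else C * exp (- 2 * t))"
        using 1 by (simp add: a_def)
    qed
  next
    case 2
    define C where "C = 2 + A * (N + R)"
    have C: "C > 0" using ANR by (simp add: C_def add_pos_nonneg)
    show ?thesis
    proof (rule reduce[OF C])
      fix t :: real assume t: "t \<ge> 0"
      \<comment> \<open>\<open>m\<close> dominates both the constant terms and the linear growth
        \<open>J t - J 0 = t\<close>.\<close>
      define m where "m = (max 1 t)\<^sup>2"
      have m: "1 \<le> m" "t \<le> m"
        using one_le_power[of "max 1 t" 2] power_increasing[of 1 2 "max 1 t"] by (auto simp: m_def)
      have "(H_norm \<mu> (?u t))\<^sup>2 \<le> 2 * exp (- 2 * a * t) + A * (N + R * (J t - J 0)) * exp (- 2 * t)"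
        by (rule bound[OF t])
      also have "\<dots> \<le> (2 * m) * exp (- 2 * t) + A * (N * m + R * m) * exp (- 2 * t)"
        using 2 t ANR m
        by (intro add_mono mult_mono mult_right_mono mult_left_mono) (auto simp: J_def mult_le_cancel_left1)
      also have "\<dots> = C * m * exp (- 2 * t)" by (simp add: C_def algebra_simps)
      finally show "(H_norm \<mu> (?u t))\<^sup>2 \<le> (if \<mu> < 3 then C * max 1 t * exp (- (\<mu> - 1) * t)
              else if \<mu> = 3 then C * (max 1 t)\<^sup>2 * exp (- 2 * t) else C * exp (- 2 * t))"
        using 2 by (simp add: a_def m_def)
    qed
  next
    case 3
    define C where "C = 2 + A * (N + R / (a - 2))"
    have C: "C > 0" using ANR 3 by (simp add: C_def add_pos_nonneg)
    show ?thesis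
    proof (rule reduce[OF C])
      fix t :: real assume t: "t \<ge> 0"
      \<comment> \<open>For \<open>a > 2\<close> the increments of \<open>J\<close> stay below
        \<open>1 / (a - 2)\<close>, so the rate \<open>exp (- 2 * t)\<close> survives; the sign is
        moved to keep denominators positive.\<close>
      have "y / (2 - a) = - (y / (a - 2))" for y using minus_divide_right[of y "a - 2"] by simp
      then have "J t - J 0 = (1 - exp ((2 - a) * t)) / (a - 2)"
        using 3 by (simp add: J_def diff_divide_distrib)
      also have "\<dots> \<le> 1 / (a - 2)" using 3 by (intro divide_right_mono) auto
      finally have J_le: "R * (J t - J 0) \<le> R * (1 / (a - 2))" using ANR by (intro mult_left_mono)
      have "(H_norm \<mu> (?u t))\<^sup>2 \<le> 2 * exp (- 2 * a * t) + A * (N + R * (J t - J 0)) * exp (- 2 * t)"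
        by (rule bound[OF t])
      also have "\<dots> \<le> 2 * exp (- 2 * t) + A * (N + R * (1 / (a - 2))) * exp (- 2 * t)"
      proof (intro add_mono mult_right_mono[OF mult_left_mono[OF add_left_mono[OF J_le] ANR(1)]])
        show "2 * exp (- 2 * a * t) \<le> 2 * exp (- 2 * t)"
          using mult_right_mono[of 1 a t] 3 t by simp
      qed simp
      also have "\<dots> = C * exp (- 2 * t)" by (simp add: C_def algebra_simps)
      finally show "(H_norm \<mu> (?u t))\<^sup>2 \<le> (if \<mu> < 3 then C * max 1 t * exp (- (\<mu> - 1) * t)
              else if \<mu> = 3 then C * (max 1 t)\<^sup>2 * exp (- 2 * t) else C * exp (- 2 * t))"
        using 3 by (simp add: a_def)
    qed
  qed
qed

end
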